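(* Let $n$ be a fixed nonnegative integer, let $f_0,\dots,f_n$ be entire functions that are real-valued on the real line, let $\eta_0,\dots,\eta_n$ be independent identically distributed $N(0,1)$ random variables, and let $P_n(z)=\sum_{j=0}^n \eta_j f_j(z)$ for $z\in\mathbb{C}$. For $\Omega\subset\mathbb{C}$ let $\nu_n(\Omega)$ denote the (random) number of zeros of $P_n$ in $\Omega$. Then for each measurable set $\Omega\subset\{z\in\mathbb{C} : D_0(z)\neq 0\}$, $$\mathbf{E}\,\nu_n(\Omega)=\int_\Omega h_n(x,y)\,dx\,dy,$$ where, with $z=x+iy$ and all functions on the right evaluated at $z$, $$h_n(x,y)=h_n(z)=\frac{B_2D_0^2-B_0\left(|B_1|^2+|A_1|^2\right)+\left(A_0B_1\overline{A_1}+\overline{A_0B_1}\,A_1\right)}{\pi D_0^3}.$$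
   Context: Here $A_0(z)=\sum_{j=0}^n f_j(z)^2$, $A_1(z)=\sum_{j=0}^n f_j(z)f_j'(z)$, $B_0(z)=\sum_{j=0}^n |f_j(z)|^2$, $B_1(z)=\sum_{j=0}^n \overline{f_j(z)}f_j'(z)$, $B_2(z)=\sum_{j=0}^n |f_j'(z)|^2$, and $D_0(z)=\sqrt{B_0(z)^2-|A_0(z)|^2}$ (nonnegative square root). Primes denote differentiation with respect to $z$, overbars denote complex conjugation, and $x,y$ are the real and imaginary parts of $z$. The symbol $\mathbf{E}$ denotes expectation. *)

theory Defs
  imports "HOL-Complex_Analysis.Complex_Analysis" "HOL-Probability.Probability"
begin

definition A\<^sub>0 :: "nat \<Rightarrow> (nat \<Rightarrow> complex \<Rightarrow> complex) \<Rightarrow> complex \<Rightarrow> complex" where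
  "A\<^sub>0 n f z = (\<Sum>j\<le>n. (f j z)\<^sup>2)"

definition A\<^sub>1 :: "nat \<Rightarrow> (nat \<Rightarrow> complex \<Rightarrow> complex) \<Rightarrow> complex \<Rightarrow> complex" where
  "A\<^sub>1 n f z = (\<Sum>j\<le>n. f j z * deriv (f j) z)"

definition B\<^sub>0 :: "nat \<Rightarrow> (nat \<Rightarrow> complex \<Rightarrow> complex) \<Rightarrow> complex \<Rightarrow> real" where
  "B\<^sub>0 n f z = (\<Sum>j\<le>n. (cmod (f j z))\<^sup>2)"

definition B\<^sub>1 :: "nat \<Rightarrow> (nat \<Rightarrow> complex \<Rightarrow> complex) \<Rightarrow> complex \<Rightarrow> complex" where
  "B\<^sub>1 n f z = (\<Sum>j\<le>n. cnj (f j z) * deriv (f j) z)"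

definition B\<^sub>2 :: "nat \<Rightarrow> (nat \<Rightarrow> complex \<Rightarrow> complex) \<Rightarrow> complex \<Rightarrow> real" where
  "B\<^sub>2 n f z = (\<Sum>j\<le>n. (cmod (deriv (f j) z))\<^sup>2)"

text \<open>The radicand is nonnegative by the triangle inequality.\<close>

definition D\<^sub>0 :: "nat \<Rightarrow> (nat \<Rightarrow> complex \<Rightarrow> complex) \<Rightarrow> complex \<Rightarrow> real" where
  "D\<^sub>0 n f z = sqrt ((B\<^sub>0 n f z)\<^sup>2 - (cmod (A\<^sub>0 n f z))\<^sup>2)"

text \<open>
  The argument of \<^const>\<open>Re\<close> is the sum of a number and its conjugate, hence already real;
  \<^const>\<open>Re\<close> only changes its type.
\<close>

definition zero_density :: "nat \<Rightarrow> (nat \<Rightarrow> complex \<Rightarrow> complex) \<Rightarrow> complex \<Rightarrow> real" where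
  "zero_density n f z =
     (B\<^sub>2 n f z * (D\<^sub>0 n f z)\<^sup>2
      - B\<^sub>0 n f z * ((cmod (B\<^sub>1 n f z))\<^sup>2 + (cmod (A\<^sub>1 n f z))\<^sup>2)
      + Re (A\<^sub>0 n f z * B\<^sub>1 n f z * cnj (A\<^sub>1 n f z)
            + cnj (A\<^sub>0 n f z * B\<^sub>1 n f z) * A\<^sub>1 n f z))
     / (pi * (D\<^sub>0 n f z) ^ 3)"

definition random_sum ::
    "nat \<Rightarrow> (nat \<Rightarrow> complex \<Rightarrow> complex) \<Rightarrow> (nat \<Rightarrow> 'a \<Rightarrow> real) \<Rightarrow> 'a \<Rightarrow> complex \<Rightarrow> complex" where
  "random_sum n f \<eta> \<omega> z = (\<Sum>j\<le>n. complex_of_real (\<eta> j \<omega>) * f j z)"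

text \<open>
  Multiplicity of \<open>z\<close> as a zero of the entire function \<open>g\<close>.  The library constant
  \<^const>\<open>zorder\<close> is unspecified for the zero function, whose zeros get multiplicity \<open>\<infinity>\<close>.
\<close>

definition zero_mult :: "(complex \<Rightarrow> complex) \<Rightarrow> complex \<Rightarrow> ennreal" where
  "zero_mult g z =
     (if g z \<noteq> 0 then 0
      else if \<forall>w. g w = 0 then \<infinity>
      else ennreal (real_of_int (zorder g z)))"

text \<open>Number of zeros in \<open>\<Omega>\<close>, counted with multiplicity, as in the argument principle.\<close>

definition num_zeros :: "(complex \<Rightarrow> complex) \<Rightarrow> complex set \<Rightarrow> ennreal" where
  "num_zeros g \<Omega> = (\<integral>\<^sup>+ z. zero_mult g z \<partial>count_space \<Omega>)"

end

theory Submission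
  imports Defs
begin

text \<open>
  Fix two indices \<open>j \<noteq> k\<close> and work where \<open>f\<^sub>j\<close> and \<open>f\<^sub>k\<close> are linearly independent over the reals, i.e.
  \<open>K = Im (f\<^sub>j cnj f\<^sub>k) \<noteq> 0\<close>; since \<open>D\<^sub>0\<^sup>2 = 2 \<Sum>\<^sub>i \<Sum>\<^sub>l Im (f\<^sub>i cnj f\<^sub>l)\<^sup>2\<close>, such sets cover the region
  \<open>D\<^sub>0 \<noteq> 0\<close>.  Condition on the remaining coefficients.  Then \<open>z\<close> is a zero of \<open>P\<close> iff the coefficients of
  \<open>f\<^sub>j, f\<^sub>k\<close> take the value \<open>F z\<close>, where \<open>F\<close> solves a real 2 by 2 linear system, and implicit
  differentiation gives the Jacobian \<open>|P'|\<^sup>2 / |K|\<close> of \<open>F\<close>.  The area formula turns the expected number of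
  zeros into an integral over \<open>z\<close>, and its degenerate case (Sard) shows that almost surely all these zeros
  are simple.

  The integrand at \<open>z\<close> is a Gaussian second moment of \<open>P'\<close> restricted to \<open>P = 0\<close>.  Write
  \<open>f\<^sub>i' = \<alpha> f\<^sub>i + \<beta> cnj f\<^sub>i + q\<^sub>i\<close> with \<open>q\<close> orthogonal to both \<open>f\<close> and \<open>cnj f\<close>.  On \<open>P = 0\<close> the
  derivative is \<open>Q = \<Sum>\<^sub>i q\<^sub>i \<eta>\<^sub>i\<close>, which is independent of \<open>P\<close>; hence the moment is \<open>\<Sum>\<^sub>i |q\<^sub>i|\<^sup>2\<close> divided by
  \<open>\<integral> exp (- |e y|\<^sup>2 / 2) dy = \<pi> D\<^sub>0 / |K|\<close>, where \<open>e y\<close> is the coefficient vector of least norm on which the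
  sum equals \<open>Re y f\<^sub>j + Im y f\<^sub>k\<close>.

  Counting is measurable for F-sigma sets of \<open>z\<close>; Lebesgue sets differ from these by null sets, which
  almost surely contain no zero because they lie in open sets of small expected count.
\<close>

section \<open>The area formula\<close>


text \<open>Change of variables for absolutely integrable vector-valued functions, applied to
  \<open>\<phi>\<close> read as a map into \<open>real^1\<close>. Since the integrands are
  nonnegative, the signed integrals turn into extended nonnegative ones.\<close>

lemma nn_integral_change_of_variables:
  fixes g :: "real^'m::{finite,wellorder} \<Rightarrow> real^'m::_" and \<phi> :: "real^'m::_ \<Rightarrow> real"
  assumes S: "S \<in> sets lebesgue"
    and der: "\<And>x. x \<in> S \<Longrightarrow> (g has_derivative g' x) (at x within S)"
    and inj: "inj_on g S"
    and \<phi>: "integrable lborel \<phi>" and nonneg: "\<And>y. 0 \<le> \<phi> y"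
  shows "g ` S \<in> sets lebesgue"
    and "(\<integral>\<^sup>+y\<in>g ` S. ennreal (\<phi> y) \<partial>lebesgue)
         = (\<integral>\<^sup>+x\<in>S. ennreal (\<bar>det (matrix (g' x))\<bar> * \<phi> (g x)) \<partial>lebesgue)"
proof -
  have "g differentiable_on S"
    using der by (auto simp: differentiable_on_def differentiable_def)
  then show *: "g ` S \<in> sets lebesgue"
    using S by (intro differentiable_image_in_sets_lebesgue) auto
  have nn: "(\<integral>\<^sup>+x\<in>A. ennreal (F x) \<partial>lebesgue) = ennreal (integral A F)"
    if "F absolutely_integrable_on A" "\<And>x. 0 \<le> F x" for F :: "real^'m::_ \<Rightarrow> real" and A
  proof -
    have "(\<integral>\<^sup>+x\<in>A. ennreal (F x) \<partial>lebesgue) = (\<integral>\<^sup>+x. ennreal (indicator A x *\<^sub>R F x) \<partial>lebesgue)"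
      by (intro nn_integral_cong) (auto simp: indicator_def)
    also have "\<dots> = ennreal (\<integral>x. indicator A x *\<^sub>R F x \<partial>lebesgue)"
      using that by (intro nn_integral_eq_integral) (auto simp: set_integrable_def)
    also have "(\<integral>x. indicator A x *\<^sub>R F x \<partial>lebesgue) = integral A F"
      using set_lebesgue_integral_eq_integral(2)[OF that(1)] by (simp add: set_lebesgue_integral_def)
    finally show ?thesis .
  qed
  define \<psi> :: "real^'m::_ \<Rightarrow> real^1" where "\<psi> = (\<lambda>y. vec (\<phi> y))"
  have "integrable lebesgue \<phi>" using \<phi> by (simp add: integrable_completion)
  then have ai: "\<phi> absolutely_integrable_on g ` S"
    using * unfolding set_integrable_def by (intro integrable_mult_indicator) auto
  then have "\<psi> absolutely_integrable_on g ` S"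
    unfolding \<psi>_def absolutely_integrable_on_1_iff by simp
  then have "(\<lambda>x. \<bar>det (matrix (g' x))\<bar> *\<^sub>R \<psi> (g x)) absolutely_integrable_on S \<and>
             integral S (\<lambda>x. \<bar>det (matrix (g' x))\<bar> *\<^sub>R \<psi> (g x)) = integral (g ` S) \<psi>"
    using has_absolute_integral_change_of_variables[OF S der inj, of \<psi> "integral (g ` S) \<psi>"]
    by simp
  then have "(\<lambda>x. \<bar>det (matrix (g' x))\<bar> * \<phi> (g x)) absolutely_integrable_on S \<and>
             integral S (\<lambda>x. \<bar>det (matrix (g' x))\<bar> * \<phi> (g x)) = integral (g ` S) \<phi>"
    unfolding absolutely_integrable_on_1_iff integral_on_1_eq vec_eq_iff
    by (simp add: \<psi>_def)
  then show "(\<integral>\<^sup>+y\<in>g ` S. ennreal (\<phi> y) \<partial>lebesgue)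
         = (\<integral>\<^sup>+x\<in>S. ennreal (\<bar>det (matrix (g' x))\<bar> * \<phi> (g x)) \<partial>lebesgue)"
    using nn[OF ai] nn[of S "\<lambda>x. \<bar>det (matrix (g' x))\<bar> * \<phi> (g x)"] nonneg by auto
qed

text \<open>By injectivity each piece contributes at most one preimage, namely when its image
  contains \<open>y\<close>; disjointness makes the contributions add up.\<close>

lemma emeasure_count_space_preimage_UN:
  assumes "disjoint_family T" "\<And>i. inj_on g (T i)"
  shows "emeasure (count_space UNIV) {x\<in>(\<Union>i::nat. T i). g x = y} = (\<Sum>i. indicator (g ` T i) y)"
proof -
  have eq: "{x\<in>(\<Union>i. T i). g x = y} = (\<Union>i. {x\<in>T i. g x = y})" by auto
  have "(\<Sum>i. emeasure (count_space UNIV) {x\<in>T i. g x = y}) = emeasure (count_space UNIV) (\<Union>i. {x\<in>T i. g x = y})"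
    using assms(1) by (intro suminf_emeasure) (auto simp: disjoint_family_on_def)
  moreover have "emeasure (count_space UNIV) {x\<in>T i. g x = y} = indicator (g ` T i) y" for i
  proof (cases "y \<in> g ` T i")
    case True
    then obtain x where "x \<in> T i" "g x = y" by auto
    then have "{x\<in>T i. g x = y} = {x}" using assms(2)[of i] by (auto simp: inj_on_def)
    then show ?thesis using True by simp
  next
    case False
    then have "{x\<in>T i. g x = y} = {}" by auto
    with False show ?thesis by (simp only:) simp
  qed
  ultimately show ?thesis using eq by simp
qed

text \<open>The critical part of \<open>S\<close> has a null image by Sard. The rest is covered, by
  Lindelof, with countably many balls of injectivity; after cutting it into disjoint pieces, change
  of variables applies on each. Local injectivity is assumed separately because a derivative that is
  invertible at a single point does not provide it without continuity.\<close>

lemma area_formula: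
  fixes g :: "real^'m::{finite,wellorder} \<Rightarrow> real^'m::_" and \<phi> :: "real^'m::_ \<Rightarrow> real"
  assumes S: "S \<in> sets lebesgue"
    and der: "\<And>x. x \<in> S \<Longrightarrow> (g has_derivative g' x) (at x within S)"
    and inj: "\<And>x. x \<in> S \<Longrightarrow> det (matrix (g' x)) \<noteq> 0 \<Longrightarrow> \<exists>r>0. inj_on g (ball x r \<inter> S)"
    and \<phi>: "integrable lborel \<phi>" and nonneg: "\<And>y. 0 \<le> \<phi> y"
  shows "(\<integral>\<^sup>+y. emeasure (count_space UNIV) {x\<in>S. g x = y} * ennreal (\<phi> y) \<partial>lebesgue)
         = (\<integral>\<^sup>+x\<in>S. ennreal (\<bar>det (matrix (g' x))\<bar> * \<phi> (g x)) \<partial>lebesgue)"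
proof -
  define d where "d = (\<lambda>x. det (matrix (g' x)))"
  have d: "d \<in> borel_measurable (lebesgue_on S)"
    unfolding d_def using S der by (rule borel_measurable_det_Jacobian)
  define S0 where "S0 = {x\<in>S. d x = 0}"
  define S1 where "S1 = {x\<in>S. d x \<noteq> 0}"
  have "{x\<in>space (lebesgue_on S). d x = 0} \<in> sets (lebesgue_on S)" using d by measurable
  then have S0: "S0 \<in> sets lebesgue"
    using S by (simp add: S0_def sets_restrict_space_iff space_restrict_space)
  have S1_eq: "S1 = S - S0" by (auto simp: S0_def S1_def)
  then have S1: "S1 \<in> sets lebesgue" using S S0 by auto
  have "negligible (g ` S0)"
  proof (rule baby_Sard)
    fix x assume x: "x \<in> S0"
    then show "(g has_derivative g' x) (at x within S0)"
      using der[of x] by (auto simp: S0_def intro: has_derivative_subset)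
    have "\<not> invertible (matrix (g' x))" using x by (simp add: S0_def d_def invertible_det_nz)
    then show "rank (matrix (g' x)) < CARD('m)"
      using full_rank_injective[of "matrix (g' x)"] rank_bound[of "matrix (g' x)"]
        matrix_left_invertible_injective[of "matrix (g' x)"] invertible_left_inverse
      by (metis le_neq_implies_less min.idem)
  qed simp
  then have null0: "g ` S0 \<in> null_sets lebesgue" by (simp add: negligible_iff_null_sets)
  have "\<forall>x\<in>S1. \<exists>r>0. inj_on g (ball x r \<inter> S)" using inj by (auto simp: S1_def d_def)
  then obtain r where r: "\<And>x. x \<in> S1 \<Longrightarrow> r x > 0 \<and> inj_on g (ball x (r x) \<inter> S)" by metis
  obtain \<F> where \<F>: "\<F> \<subseteq> (\<lambda>x. ball x (r x)) ` S1" "countable \<F>" "\<Union>\<F> = \<Union>((\<lambda>x. ball x (r x)) ` S1)"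
    by (rule Lindelof[of "(\<lambda>x. ball x (r x)) ` S1"]) auto
  have ex: "\<exists>B::nat \<Rightarrow> _ set. (\<forall>i. open (B i) \<and> inj_on g (B i \<inter> S)) \<and> S1 \<subseteq> (\<Union>i. B i)"
  proof (cases "\<F> = {}")
    case True
    then have "S1 = {}" using \<F>(3) r by fastforce
    then show ?thesis by (intro exI[of _ "\<lambda>_. {}"]) auto
  next
    case False
    then obtain B :: "nat \<Rightarrow> _" where B: "range B = \<F>" using \<F>(2) uncountable_def by metis
    have "B i \<in> (\<lambda>x. ball x (r x)) ` S1" for i using B \<F>(1) by auto
    then have "open (B i) \<and> inj_on g (B i \<inter> S)" for i
      using r by (metis (no_types, lifting) imageE open_ball)
    moreover have "S1 \<subseteq> \<Union>\<F>" unfolding \<F>(3) using r by (auto intro!: bexI)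
    ultimately show ?thesis using B by blast
  qed
  then obtain B :: "nat \<Rightarrow> _ set" where B: "\<And>i. open (B i)" "\<And>i. inj_on g (B i \<inter> S)" "S1 \<subseteq> (\<Union>i. B i)"
    by blast
  define T where "T = disjointed (\<lambda>i. B i \<inter> S1)"
  have T_sub: "T i \<subseteq> B i \<inter> S1" for i unfolding T_def by (rule disjointed_subset)
  have T_disj: "disjoint_family T" unfolding T_def by (rule disjoint_family_disjointed)
  have T_UN: "(\<Union>i. T i) = S1" unfolding T_def UN_disjointed_eq using B(3) by auto
  have "range T \<subseteq> sets lebesgue"
    unfolding T_def using B(1) S1 by (intro sets.range_disjointed_sets) auto
  then have T: "T i \<in> sets lebesgue" for i by auto
  have "S1 \<subseteq> S" by (auto simp: S1_def)
  have T_inj: "inj_on g (T i)" for i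
    using B(2)[of i] T_sub[of i] \<open>S1 \<subseteq> S\<close> by (rule_tac inj_on_subset) auto
  have T_der: "(g has_derivative g' x) (at x within T i)" if "x \<in> T i" for i x
    using that T_sub[of i] \<open>S1 \<subseteq> S\<close> der[of x] by (auto intro: has_derivative_subset)
  have cv: "g ` T i \<in> sets lebesgue" "(\<integral>\<^sup>+y\<in>g ` T i. ennreal (\<phi> y) \<partial>lebesgue)
         = (\<integral>\<^sup>+x\<in>T i. ennreal (\<bar>d x\<bar> * \<phi> (g x)) \<partial>lebesgue)" for i
    unfolding d_def using nn_integral_change_of_variables[OF T T_der T_inj \<phi> nonneg] by auto
  have [measurable]: "\<phi> \<in> borel_measurable lborel" using \<phi> by auto
  have \<phi>_leb[measurable]: "\<phi> \<in> borel_measurable lebesgue" by (rule measurable_completion) simp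
  have gS: "g \<in> borel_measurable (lebesgue_on S)"
    using S der by (intro continuous_imp_measurable_on_sets_lebesgue)
       (auto simp: continuous_on_eq_continuous_within intro: has_derivative_continuous)
  \<comment> \<open>\<open>g\<close> is controlled only on \<open>S\<close>, so the integrand is cut
    off outside \<open>S\<close> before measurability on the whole space is claimed.\<close>
  define G where "G = (\<lambda>x. ennreal (\<bar>d x\<bar> * \<phi> (g x)) * indicator S x)"
  have "(\<lambda>x. \<phi> (g x)) \<in> borel_measurable (lebesgue_on S)"
    using measurable_compose[OF gS, of \<phi> borel] by simp
  then have "(\<lambda>x. ennreal (\<bar>d x\<bar> * \<phi> (g x))) \<in> borel_measurable (lebesgue_on S)"
    using d by measurable
  then have G[measurable]: "G \<in> borel_measurable lebesgue"
    unfolding G_def using S by (subst borel_measurable_restrict_space_iff_ennreal[symmetric]) auto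
  \<comment> \<open>Off the null image of \<open>S0\<close> a fibre contains no critical point, so
    it can be counted piece by piece.\<close>
  have "(\<integral>\<^sup>+y. emeasure (count_space UNIV) {x\<in>S. g x = y} * ennreal (\<phi> y) \<partial>lebesgue)
      = (\<integral>\<^sup>+y. (\<Sum>i. ennreal (\<phi> y) * indicator (g ` T i) y) \<partial>lebesgue)"
  proof (rule nn_integral_cong_AE)
    show "AE y in lebesgue. emeasure (count_space UNIV) {x\<in>S. g x = y} * ennreal (\<phi> y)
        = (\<Sum>i. ennreal (\<phi> y) * indicator (g ` T i) y)"
      using AE_not_in[OF null0]
    proof eventually_elim
      case (elim y)
      then have "{x\<in>S. g x = y} = {x\<in>(\<Union>i. T i). g x = y}"
        unfolding T_UN by (auto simp: S0_def S1_def)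
      then show ?case
        using emeasure_count_space_preimage_UN[of T g y] T_disj T_inj
        by (simp add: mult.commute)
    qed
  qed
  also have "\<dots> = (\<Sum>i. (\<integral>\<^sup>+y\<in>g ` T i. ennreal (\<phi> y) \<partial>lebesgue))"
    using cv(1) by (intro nn_integral_suminf borel_measurable_times_ennreal borel_measurable_indicator
      measurable_compose[OF \<phi>_leb measurable_ennreal]) auto
  also have "\<dots> = (\<Sum>i. (\<integral>\<^sup>+x. G x * indicator (T i) x \<partial>lebesgue))"
    unfolding cv(2) using T_sub \<open>S1 \<subseteq> S\<close>
    by (intro suminf_cong nn_integral_cong) (force simp: G_def indicator_def)
  also have "\<dots> = (\<integral>\<^sup>+x. (\<Sum>i. G x * indicator (T i) x) \<partial>lebesgue)"
    using T by (intro nn_integral_suminf[symmetric] borel_measurable_times_ennreal G borel_measurable_indicator) auto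
  also have "\<dots> = (\<integral>\<^sup>+x. G x * indicator S1 x \<partial>lebesgue)"
    using suminf_indicator[OF T_disj] by (simp add: T_UN)
  also have "\<dots> = (\<integral>\<^sup>+x\<in>S. ennreal (\<bar>d x\<bar> * \<phi> (g x)) \<partial>lebesgue)"
    by (intro nn_integral_cong) (auto simp: G_def S1_def indicator_def)
  finally show ?thesis by (simp add: d_def)
qed


section \<open>The complex plane as real^2\<close>

definition complex_of_vec :: "real^2 \<Rightarrow> complex" where
  "complex_of_vec v = Complex (v $ 1) (v $ 2)"

definition vec_of_complex :: "complex \<Rightarrow> real^2" where
  "vec_of_complex z = vector [Re z, Im z]"

lemma complex_of_vec_inverse [simp]: "vec_of_complex (complex_of_vec v) = v"
  by (simp add: vec_of_complex_def complex_of_vec_def vec_eq_iff forall_2)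

lemma vec_of_complex_inverse [simp]: "complex_of_vec (vec_of_complex z) = z"
  by (simp add: vec_of_complex_def complex_of_vec_def)

lemma linear_complex_of_vec: "linear complex_of_vec"
  by (rule linearI) (auto simp: complex_of_vec_def complex_eq_iff)

lemma linear_vec_of_complex: "linear vec_of_complex"
  by (rule linearI) (auto simp: vec_of_complex_def vec_eq_iff forall_2)

lemma bounded_linear_complex_of_vec: "bounded_linear complex_of_vec"
  using linear_complex_of_vec by (rule linear_conv_bounded_linear[THEN iffD1])

lemma bounded_linear_vec_of_complex: "bounded_linear vec_of_complex"
  using linear_vec_of_complex by (rule linear_conv_bounded_linear[THEN iffD1])

lemma measurable_complex_of_vec [measurable]: "complex_of_vec \<in> borel_measurable borel"
  by (intro borel_measurable_continuous_onI linear_continuous_on bounded_linear_complex_of_vec)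

lemma measurable_vec_of_complex [measurable]: "vec_of_complex \<in> borel_measurable borel"
  by (intro borel_measurable_continuous_onI linear_continuous_on bounded_linear_vec_of_complex)

lemma norm_complex_of_vec [simp]: "norm (complex_of_vec v) = norm v"
  by (simp add: complex_of_vec_def cmod_def norm_vec_def L2_set_def sum_2)

lemma dist_complex_of_vec [simp]: "dist (complex_of_vec v) (complex_of_vec w) = dist v w"
  by (simp add: dist_norm flip: linear_diff[OF linear_complex_of_vec])

lemma axis_1_2_eq: "axis 1 1 = vec_of_complex 1" "axis 2 1 = vec_of_complex \<i>"
  by (simp_all add: vec_of_complex_def vec_eq_iff forall_2 axis_def)

lemma complex_of_vec_axis [simp]: "complex_of_vec (axis 1 1) = 1" "complex_of_vec (axis 2 1) = \<i>"
  by (simp_all add: axis_1_2_eq)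

text \<open>Lebesgue measure is determined by its values on boxes, and boxes correspond to boxes
  with the same side lengths.\<close>

lemma lborel_distr_complex_of_vec: "distr lborel borel complex_of_vec = lborel"
proof (rule lborel_eqI[symmetric])
  fix l u :: complex
  assume le: "\<And>b. b \<in> Basis \<Longrightarrow> l \<bullet> b \<le> u \<bullet> b"
  have le': "Re l \<le> Re u" "Im l \<le> Im u"
    using le[of 1] le[of \<i>] by (auto simp: Basis_complex_def inner_complex_def)
  have eq: "complex_of_vec -` box l u = box (vec_of_complex l) (vec_of_complex u)"
    by (rule set_eqI) (simp add: mem_box_cart in_box_complex_iff forall_2 complex_of_vec_def vec_of_complex_def conj_ac)
  have "emeasure (distr lborel borel complex_of_vec) (box l u)
      = emeasure lborel (box (vec_of_complex l) (vec_of_complex u))"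
    by (simp add: emeasure_distr eq)
  also have "\<dots> = ennreal (\<Prod>b\<in>Basis. (vec_of_complex u - vec_of_complex l) \<bullet> b)"
  proof (rule emeasure_lborel_box)
    fix b :: "real^2" assume "b \<in> Basis"
    then have "b = axis 1 1 \<or> b = axis 2 1"
      by (auto simp: Basis_vec_def) (metis exhaust_2)
    then show "vec_of_complex l \<bullet> b \<le> vec_of_complex u \<bullet> b"
      using le' by (auto simp: inner_axis vec_of_complex_def)
  qed
  also have "(\<Prod>b\<in>Basis. (vec_of_complex u - vec_of_complex l) \<bullet> b) = (\<Prod>b\<in>Basis. (u - l) \<bullet> b)"
  proof -
    have B: "(Basis :: (real^2) set) = {axis 1 1, axis 2 1}"
      by (auto simp: Basis_vec_def) (metis exhaust_2)
    have "axis 1 1 \<noteq> (axis 2 1 :: real^2)" by (simp add: axis_eq_axis)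
    then show ?thesis
      by (simp add: B Basis_complex_def inner_axis inner_complex_def vec_of_complex_def)
  qed
  finally show "emeasure (distr lborel borel complex_of_vec) (box l u) = ennreal (\<Prod>b\<in>Basis. (u - l) \<bullet> b)" .
qed simp

lemma nn_integral_lborel_complex_of_vec:
  assumes [measurable]: "h \<in> borel_measurable borel"
  shows "(\<integral>\<^sup>+z. h z \<partial>lborel) = (\<integral>\<^sup>+v. h (complex_of_vec v) \<partial>lborel)"
  by (subst lborel_distr_complex_of_vec[symmetric]) (simp add: nn_integral_distr)

text \<open>The same test on boxes; it yields Fubini in the real and imaginary parts.\<close>

lemma lborel_distr_Complex: "distr (lborel \<Otimes>\<^sub>M lborel) borel (\<lambda>(a, b). Complex a b) = lborel"
proof (rule lborel_eqI[symmetric])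
  fix l u :: complex
  assume le: "\<And>b. b \<in> Basis \<Longrightarrow> l \<bullet> b \<le> u \<bullet> b"
  have le': "Re l \<le> Re u" "Im l \<le> Im u"
    using le[of 1] le[of \<i>] by (auto simp: Basis_complex_def inner_complex_def)
  have eq: "(\<lambda>(a, b). Complex a b) -` box l u = {Re l<..<Re u} \<times> {Im l<..<Im u}"
    by (auto simp: box_def Basis_complex_def inner_complex_def)
  have m: "(\<lambda>(a, b). Complex a b) \<in> borel_measurable (lborel \<Otimes>\<^sub>M lborel)"
    unfolding Complex_eq by (simp add: split_beta')
  have "emeasure (distr (lborel \<Otimes>\<^sub>M lborel) borel (\<lambda>(a, b). Complex a b)) (box l u)
      = emeasure (lborel \<Otimes>\<^sub>M lborel) ({Re l<..<Re u} \<times> {Im l<..<Im u})"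
    using m by (simp add: emeasure_distr eq space_pair_measure)
  also have "\<dots> = ennreal (Re u - Re l) * ennreal (Im u - Im l)"
    using le' by (subst lborel.emeasure_pair_measure_Times) auto
  also have "\<dots> = ennreal (\<Prod>b\<in>Basis. (u - l) \<bullet> b)"
    using le' by (simp add: Basis_complex_def inner_complex_def ennreal_mult)
  finally show "emeasure (distr (lborel \<Otimes>\<^sub>M lborel) borel (\<lambda>(a, b). Complex a b)) (box l u)
      = ennreal (\<Prod>b\<in>Basis. (u - l) \<bullet> b)" .
qed simp

lemma measurable_Complex [measurable]: "(\<lambda>(a, b). Complex a b) \<in> borel_measurable (lborel \<Otimes>\<^sub>M lborel)"
  unfolding Complex_eq by (simp add: split_beta')

lemma nn_integral_lborel_Complex:
  assumes [measurable]: "h \<in> borel_measurable borel"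
  shows "(\<integral>\<^sup>+z. h z \<partial>lborel) = (\<integral>\<^sup>+a. \<integral>\<^sup>+b. h (Complex a b) \<partial>lborel \<partial>lborel)"
proof -
  have "(\<integral>\<^sup>+z. h z \<partial>lborel) = (\<integral>\<^sup>+p. h ((\<lambda>(a, b). Complex a b) p) \<partial>(lborel \<Otimes>\<^sub>M lborel))"
    by (subst lborel_distr_Complex[symmetric]) (rule nn_integral_distr; measurable)
  also have "\<dots> = (\<integral>\<^sup>+a. \<integral>\<^sup>+b. h (Complex a b) \<partial>lborel \<partial>lborel)"
    using measurable_compose[OF measurable_Complex assms]
    by (subst lborel.nn_integral_fst[symmetric]) (auto simp: split_beta')
  finally show ?thesis .
qed

text \<open>The determinant over the reals in the basis \<open>1\<close>, \<open>\<i>\<close>, with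
  columns \<open>L 1\<close> and \<open>L \<i>\<close>.\<close>

definition real_det :: "(complex \<Rightarrow> complex) \<Rightarrow> real" where
  "real_det L = Re (L 1) * Im (L \<i>) - Im (L 1) * Re (L \<i>)"

lemma det_matrix_eq_real_det:
  "det (matrix (\<lambda>v. vec_of_complex (L (complex_of_vec v)))) = real_det L"
  by (simp add: det_2 matrix_def real_det_def vec_of_complex_def mult.commute)

text \<open>\<open>complex_of_vec\<close> is a measure-preserving isometry, so it carries
  derivatives, balls of injectivity and fibres over from \<open>real^2\<close>. The measurability
  assumptions allow the two integrals to be transported along it.\<close>

lemma area_formula_complex:
  fixes g :: "complex \<Rightarrow> complex" and \<phi> :: "complex \<Rightarrow> real"
  assumes S [measurable]: "S \<in> sets borel"
    and der: "\<And>x. x \<in> S \<Longrightarrow> (g has_derivative g' x) (at x)"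
    and inj: "\<And>x. x \<in> S \<Longrightarrow> real_det (g' x) \<noteq> 0 \<Longrightarrow> \<exists>r>0. inj_on g (ball x r \<inter> S)"
    and \<phi>: "integrable lborel \<phi>" and nonneg: "\<And>y. 0 \<le> \<phi> y"
    and [measurable]: "(\<lambda>y. emeasure (count_space UNIV) {x\<in>S. g x = y}) \<in> borel_measurable borel"
    and [measurable]: "(\<lambda>x. ennreal (\<bar>real_det (g' x)\<bar> * \<phi> (g x)) * indicator S x) \<in> borel_measurable borel"
  shows "(\<integral>\<^sup>+y. emeasure (count_space UNIV) {x\<in>S. g x = y} * ennreal (\<phi> y) \<partial>lborel)
         = (\<integral>\<^sup>+x\<in>S. ennreal (\<bar>real_det (g' x)\<bar> * \<phi> (g x)) \<partial>lborel)"
proof -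
  let ?e = complex_of_vec and ?e' = vec_of_complex
  define S' where "S' = ?e -` S"
  define G where "G = (\<lambda>v. ?e' (g (?e v)))"
  define G' where "G' = (\<lambda>v w. ?e' (g' (?e v) (?e w)))"
  have [measurable]: "S' \<in> sets borel"
    using measurable_sets[OF measurable_complex_of_vec S] by (simp add: S'_def)
  have [measurable]: "\<phi> \<in> borel_measurable borel" using \<phi> by auto
  have der': "(G has_derivative G' v) (at v within S')" if "v \<in> S'" for v
  proof (rule has_derivative_at_withinI)
    have "(?e has_derivative ?e) (at v)"
      using bounded_linear_complex_of_vec by (rule bounded_linear_imp_has_derivative)
    moreover have "(g has_derivative g' (?e v)) (at (?e v))" using der that by (simp add: S'_def)
    ultimately have "((\<lambda>v. g (?e v)) has_derivative (\<lambda>w. g' (?e v) (?e w))) (at v)"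
      by (rule has_derivative_compose)
    then show "(G has_derivative G' v) (at v)"
      unfolding G_def G'_def by (rule bounded_linear.has_derivative[OF bounded_linear_vec_of_complex])
  qed
  have det: "det (matrix (G' v)) = real_det (g' (?e v))" for v
    unfolding G'_def by (rule det_matrix_eq_real_det)
  have inj': "\<exists>r>0. inj_on G (ball v r \<inter> S')" if v: "v \<in> S'" "det (matrix (G' v)) \<noteq> 0" for v
  proof -
    obtain r where r: "r > 0" "inj_on g (ball (?e v) r \<inter> S)"
      using inj[of "?e v"] v by (auto simp: S'_def det)
    have "inj_on G (ball v r \<inter> S')"
    proof (rule inj_onI)
      fix x y assume xy: "x \<in> ball v r \<inter> S'" "y \<in> ball v r \<inter> S'" "G x = G y"
      have "g (?e x) = g (?e y)" using xy(3) by (metis G_def vec_of_complex_inverse)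
      moreover have "?e x \<in> ball (?e v) r \<inter> S" "?e y \<in> ball (?e v) r \<inter> S"
        using xy(1,2) by (simp_all add: S'_def)
      ultimately have "?e x = ?e y" by (rule inj_onD[OF r(2)])
      then show "x = y" by (metis complex_of_vec_inverse)
    qed
    then show ?thesis using r by auto
  qed
  have int: "integrable lborel (\<lambda>v. \<phi> (?e v))"
    using \<phi> integrable_distr_eq[of ?e lborel borel \<phi>] by (simp add: lborel_distr_complex_of_vec)
  have "emeasure (count_space UNIV) {x\<in>S. g x = ?e w} = emeasure (count_space UNIV) {v\<in>S'. G v = w}" for w
  proof -
    have "{x\<in>S. g x = ?e w} = ?e ` {v\<in>S'. G v = w}"
    proof safe
      fix x assume "x \<in> S" "g x = ?e w"
      then have "?e' x \<in> {v\<in>S'. G v = w}" by (simp add: S'_def G_def)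
      then show "x \<in> ?e ` {v\<in>S'. G v = w}" by (metis image_eqI vec_of_complex_inverse)
    qed (auto simp: S'_def G_def)
    moreover have "inj_on ?e {v\<in>S'. G v = w}" by (rule inj_onI) (metis complex_of_vec_inverse)
    ultimately show ?thesis
      by (simp add: emeasure_count_space card_image finite_image_iff)
  qed
  then have "(\<integral>\<^sup>+y. emeasure (count_space UNIV) {x\<in>S. g x = y} * ennreal (\<phi> y) \<partial>lborel)
      = (\<integral>\<^sup>+w. emeasure (count_space UNIV) {v\<in>S'. G v = w} * ennreal (\<phi> (?e w)) \<partial>lborel)"
    by (subst nn_integral_lborel_complex_of_vec) simp_all
  also have "\<dots> = (\<integral>\<^sup>+v\<in>S'. ennreal (\<bar>det (matrix (G' v))\<bar> * \<phi> (?e (G v))) \<partial>lborel)"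
    using area_formula[of S' G G' "\<lambda>v. \<phi> (?e v)", OF _ der' inj' int] nonneg
    by (simp add: nn_integral_completion)
  also have "\<dots> = (\<integral>\<^sup>+x\<in>S. ennreal (\<bar>real_det (g' x)\<bar> * \<phi> (g x)) \<partial>lborel)"
    unfolding nn_integral_lborel_complex_of_vec[OF assms(7)]
    by (intro nn_integral_cong) (simp add: det G_def S'_def indicator_def)
  finally show ?thesis .
qed


section \<open>Measurability of the number of zeros\<close>

text \<open>On a compact set a continuous function has a zero iff its norm takes arbitrarily small
  values on a countable dense subset: the norm attains its minimum. This describes the event by
  countably many evaluations.\<close>

lemma pred_ex_zero_compact:
  fixes H :: "'b \<Rightarrow> 'c::euclidean_space \<Rightarrow> 'v::real_normed_vector"
  assumes K: "compact K"
    and H [measurable]: "\<And>z. (\<lambda>c. norm (H c z)) \<in> borel_measurable M"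
    and cont: "\<And>c. c \<in> space M \<Longrightarrow> continuous_on K (H c)"
  shows "Measurable.pred M (\<lambda>c. \<exists>z\<in>K. H c z = 0)"
proof (cases "K = {}")
  case False
  obtain T where T: "countable T" "T \<subseteq> K" "K \<subseteq> closure T"
    using separable by metis
  have "(\<exists>z\<in>K. H c z = 0) \<longleftrightarrow> (\<forall>m::nat. \<exists>z\<in>T. norm (H c z) < 1 / real (Suc m))"
    if c: "c \<in> space M" for c
  proof
    assume "\<exists>z\<in>K. H c z = 0"
    then obtain z where z: "z \<in> K" "H c z = 0" by auto
    show "\<forall>m::nat. \<exists>z\<in>T. norm (H c z) < 1 / real (Suc m)"
    proof
      fix m :: nat
      obtain d where d: "d > 0" "\<And>y. y \<in> K \<Longrightarrow> dist y z < d \<Longrightarrow> dist (H c y) (H c z) < 1 / real (Suc m)"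
        using cont[OF c] z(1) unfolding continuous_on_iff
        by (metis of_nat_0_less_iff zero_less_Suc zero_less_divide_1_iff)
      obtain y where "y \<in> T" "dist y z < d"
        using T(3) z(1) d(1) closure_approachable by blast
      then show "\<exists>z\<in>T. norm (H c z) < 1 / real (Suc m)"
        using d(2)[of y] T(2) z(2) by (auto simp: dist_norm)
    qed
  next
    assume *: "\<forall>m::nat. \<exists>z\<in>T. norm (H c z) < 1 / real (Suc m)"
    obtain w where w: "w \<in> K" "\<And>y. y \<in> K \<Longrightarrow> norm (H c w) \<le> norm (H c y)"
      using continuous_attains_inf[OF K False continuous_on_norm[OF cont[OF c]]] by auto
    have "norm (H c w) \<le> 0"
    proof (rule field_le_epsilon)
      fix e :: real assume "e > 0"
      then obtain m :: nat where "1 / real (Suc m) < e" using nat_approx_posE by blast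
      moreover obtain z where "z \<in> T" "norm (H c z) < 1 / real (Suc m)" using * by blast
      ultimately show "norm (H c w) \<le> 0 + e" using w(2)[of z] T(2) by auto
    qed
    then show "\<exists>z\<in>K. H c z = 0" using w(1) by auto
  qed
  then have "Measurable.pred M (\<lambda>c. \<exists>z\<in>K. H c z = 0) \<longleftrightarrow>
      Measurable.pred M (\<lambda>c. \<forall>m::nat. \<exists>z\<in>T. norm (H c z) < 1 / real (Suc m))"
    by (intro measurable_cong) auto
  moreover have "Measurable.pred M (\<lambda>c. \<forall>m::nat. \<exists>z\<in>T. norm (H c z) < 1 / real (Suc m))"
    using T(1) by measurable
  ultimately show ?thesis by simp
qed simp

lemma fsigma_in_euclidean_UN_compact:
  fixes S :: "'c::euclidean_space set"
  assumes "fsigma_in euclidean S"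
  shows "\<exists>K::nat \<Rightarrow> 'c set. (\<forall>i. compact (K i)) \<and> S = (\<Union>i. K i)"
proof -
  obtain C :: "nat \<Rightarrow> 'c set" where C: "\<And>n. closed (C n)" "(\<Union>n. C n) = S"
    using assms unfolding fsigma_in_ascending by auto
  \<comment> \<open>Balls of growing radius make the closed sets compact. A point of
    \<open>C j\<close> of norm at most \<open>m\<close> has entered by index
    \<open>max j m\<close>.\<close>
  define L where "L = (\<lambda>i. \<Union>j\<le>i. C j \<inter> cball 0 (real i))"
  have "compact (L i)" for i
    unfolding L_def using C(1) by (intro compact_UN) (auto intro: closed_Int_compact)
  moreover have "S = (\<Union>i. L i)"
  proof
    show "S \<subseteq> (\<Union>i. L i)"
    proof
      fix x assume "x \<in> S"
      then obtain j where j: "x \<in> C j" using C(2) by auto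
      obtain m :: nat where m: "norm x \<le> real m" using real_arch_simple by blast
      have "x \<in> L (max j m)" unfolding L_def using j m by (auto intro!: bexI[of _ j])
      then show "x \<in> (\<Union>i. L i)" by auto
    qed
    show "(\<Union>i. L i) \<subseteq> S" using C(2) by (auto simp: L_def)
  qed
  ultimately show ?thesis by auto
qed

lemma fsigma_in_euclidean_borel:
  fixes S :: "'c::euclidean_space set"
  assumes "fsigma_in euclidean S"
  shows "S \<in> sets borel"
proof -
  obtain K :: "nat \<Rightarrow> 'c set" where K: "\<And>i. compact (K i)" "S = (\<Union>i. K i)"
    using fsigma_in_euclidean_UN_compact[OF assms] by auto
  show ?thesis unfolding K(2) using K(1) by (intro sets.countable_UN) (auto intro: borel_compact)
qed

lemma pred_ex_zero_fsigma:
  fixes H :: "'b \<Rightarrow> 'c::euclidean_space \<Rightarrow> 'v::real_normed_vector"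
  assumes S: "fsigma_in euclidean S"
    and H: "\<And>z. (\<lambda>c. norm (H c z)) \<in> borel_measurable M"
    and cont: "\<And>c. c \<in> space M \<Longrightarrow> continuous_on S (H c)"
  shows "Measurable.pred M (\<lambda>c. \<exists>z\<in>S. H c z = 0)"
proof -
  obtain K :: "nat \<Rightarrow> 'c set" where K: "\<And>i. compact (K i)" "S = (\<Union>i. K i)"
    using fsigma_in_euclidean_UN_compact[OF S] by auto
  have "Measurable.pred M (\<lambda>c. \<exists>z\<in>K i. H c z = 0)" for i
    using K by (intro pred_ex_zero_compact H continuous_on_subset[OF cont]) auto
  then have "Measurable.pred M (\<lambda>c. \<exists>i. \<exists>z\<in>K i. H c z = 0)" by measurable
  then show ?thesis unfolding K(2) by simp
qed

text \<open>Cells of the square grid of mesh \<open>1 / (k + 1)\<close>, numbered by naturals: counting the cells hit by a set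
  recovers its cardinality as the mesh shrinks.\<close>

definition grid_cell :: "nat \<Rightarrow> complex \<Rightarrow> nat" where
  "grid_cell k z = to_nat (\<lfloor>real (Suc k) * Re z\<rfloor>, \<lfloor>real (Suc k) * Im z\<rfloor>)"

text \<open>A cell is a half-open square, hence an intersection of open and closed half-planes. A
  number that encodes no pair of integers has an empty cell.\<close>

lemma fsigma_in_grid_cell: "fsigma_in euclidean {z. grid_cell k z = i}"
proof (cases "\<exists>p :: int \<times> int. to_nat p = i")
  case True
  then obtain a b :: int where ab: "to_nat (a, b) = i" by auto
  have eq: "{z. grid_cell k z = i} =
      ({z. of_int a \<le> real (Suc k) * Re z} \<inter> {z. real (Suc k) * Re z < of_int a + 1}) \<inter>
      ({z. of_int b \<le> real (Suc k) * Im z} \<inter> {z. real (Suc k) * Im z < of_int b + 1})"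
    unfolding ab[symmetric] grid_cell_def by (auto simp: floor_eq_iff)
  have op: "fsigma_in euclidean U" if "open U" for U :: "complex set"
    using that by (intro open_imp_fsigma_in metrizable_space_euclidean) simp
  have cl: "fsigma_in euclidean U" if "closed U" for U :: "complex set"
    using that by (intro closed_imp_fsigma_in) simp
  show ?thesis
    unfolding eq
    by (intro fsigma_in_Int op cl closed_Collect_le open_Collect_less continuous_intros)
next
  case False
  then have "{z. grid_cell k z = i} = {}" by (auto simp: grid_cell_def)
  then show ?thesis by simp
qed

text \<open>Equal floors force a difference below 1, while scaling by \<open>Suc k\<close>
  eventually stretches a nonzero coordinate difference to at least 1.\<close>

lemma eventually_grid_cell_neq:
  assumes "x \<noteq> y"
  shows "\<forall>\<^sub>F k in sequentially. grid_cell k x \<noteq> grid_cell k y"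
proof -
  have *: "\<bar>real (Suc k) * (a - b)\<bar> < 1" if "\<lfloor>real (Suc k) * a\<rfloor> = \<lfloor>real (Suc k) * b\<rfloor>" for a b :: real and k
    unfolding right_diff_distrib using that by linarith
  have ev: "\<forall>\<^sub>F k in sequentially. \<bar>real (Suc k) * (a - b)\<bar> \<ge> 1" if "a \<noteq> b" for a b :: real
  proof -
    obtain N :: nat where N: "1 / \<bar>a - b\<bar> < real N" using reals_Archimedean2 by blast
    have "\<bar>real (Suc k) * (a - b)\<bar> \<ge> 1" if "k \<ge> N" for k
    proof -
      have "1 / \<bar>a - b\<bar> \<le> real (Suc k)" using N that by simp
      then have "1 \<le> real (Suc k) * \<bar>a - b\<bar>" using \<open>a \<noteq> b\<close> by (simp only: pos_divide_le_eq zero_less_abs_iff right_minus_eq not_False_eq_True)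
      then show ?thesis unfolding abs_mult by simp
    qed
    then show ?thesis using eventually_sequentially by blast
  qed
  consider "Re x \<noteq> Re y" | "Im x \<noteq> Im y" using assms complex_eqI by blast
  then show ?thesis
  proof cases
    case 1
    show ?thesis using ev[OF 1] by eventually_elim (use * in \<open>force simp: grid_cell_def\<close>)
  next
    case 2
    show ?thesis using ev[OF 2] by eventually_elim (use * in \<open>force simp: grid_cell_def\<close>)
  qed
qed

text \<open>A fine enough grid separates the points of any given finite subset, so the supremum
  reaches the size of every finite subset of \<open>Z\<close>. The grids are not nested and the
  counts need not increase with \<open>k\<close>, hence a supremum rather than a monotone
  limit.\<close>

lemma emeasure_count_space_eq_SUP_grid_cell:
  "emeasure (count_space UNIV) Z = (SUP k. emeasure (count_space UNIV) (grid_cell k ` Z))"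
proof (rule antisym)
  show "(SUP k. emeasure (count_space UNIV) (grid_cell k ` Z)) \<le> emeasure (count_space UNIV) Z"
    by (rule SUP_least) (auto simp: emeasure_count_space card_image_le)
  have fin: "of_nat (card F) \<le> (SUP k. emeasure (count_space UNIV) (grid_cell k ` Z))"
    if F: "finite F" "F \<subseteq> Z" for F
  proof -
    have "\<forall>\<^sub>F k in sequentially. \<forall>x\<in>F. \<forall>y\<in>F. x \<noteq> y \<longrightarrow> grid_cell k x \<noteq> grid_cell k y"
      using F(1) by (intro eventually_ball_finite ballI) (auto intro: eventually_mono[OF eventually_grid_cell_neq])
    then obtain k where "\<forall>x\<in>F. \<forall>y\<in>F. x \<noteq> y \<longrightarrow> grid_cell k x \<noteq> grid_cell k y"
      using eventually_happens'[OF sequentially_bot] by blast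
    then have "inj_on (grid_cell k) F" unfolding inj_on_def by blast
    then have "of_nat (card F) = emeasure (count_space UNIV) (grid_cell k ` F)"
      using F(1) by (simp add: emeasure_count_space card_image)
    also have "\<dots> \<le> emeasure (count_space UNIV) (grid_cell k ` Z)"
      using F(2) by (intro emeasure_mono) auto
    also have "\<dots> \<le> (SUP k. emeasure (count_space UNIV) (grid_cell k ` Z))"
      by (rule SUP_upper) simp
    finally show ?thesis .
  qed
  show "emeasure (count_space UNIV) Z \<le> (SUP k. emeasure (count_space UNIV) (grid_cell k ` Z))"
  proof (cases "finite Z")
    case True
    then show ?thesis using fin[of Z] by (simp add: emeasure_count_space)
  next
    case False
    have "of_nat m \<le> (SUP k. emeasure (count_space UNIV) (grid_cell k ` Z))" for m
    proof -
      obtain F where "F \<subseteq> Z" "finite F" "card F = m" using infinite_arbitrarily_large[OF False, of m] by auto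
      then show ?thesis using fin[of F] by simp
    qed
    then have "(SUP m. of_nat m) \<le> (SUP k. emeasure (count_space UNIV) (grid_cell k ` Z))"
      by (rule SUP_least)
    then have "(SUP k. emeasure (count_space UNIV) (grid_cell k ` Z)) = \<top>"
      by (simp only: ennreal_SUP_of_nat_eq_top top_unique)
    then show ?thesis by (simp only: top_greatest)
  qed
qed

text \<open>That a given cell is hit is the event of a zero in an F-sigma set. The number of cells
  hit is a countable sum of such indicators, and its supremum over the grids is the number of
  zeros.\<close>

lemma borel_measurable_count_zeros:
  fixes H :: "'b \<Rightarrow> complex \<Rightarrow> 'v::real_normed_vector"
  assumes S: "fsigma_in euclidean S"
    and H: "\<And>z. (\<lambda>c. norm (H c z)) \<in> borel_measurable M"
    and cont: "\<And>c. c \<in> space M \<Longrightarrow> continuous_on S (H c)"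
  shows "(\<lambda>c. emeasure (count_space UNIV) {z\<in>S. H c z = 0}) \<in> borel_measurable M"
proof -
  have "Measurable.pred M (\<lambda>c. \<exists>z\<in>S \<inter> {z. grid_cell k z = i}. H c z = 0)" for k i
    by (intro pred_ex_zero_fsigma fsigma_in_Int S fsigma_in_grid_cell H continuous_on_subset[OF cont]) auto
  moreover have "(i \<in> grid_cell k ` {z\<in>S. H c z = 0}) = (\<exists>z\<in>S \<inter> {z. grid_cell k z = i}. H c z = 0)" for k i c
    by auto
  ultimately have m [measurable]: "Measurable.pred M (\<lambda>c. i \<in> grid_cell k ` {z\<in>S. H c z = 0})" for k i
    by simp
  have "emeasure (count_space UNIV) A = (\<Sum>i. if i \<in> A then 1 else 0)" for A :: "nat set"
  proof -
    have "emeasure (count_space UNIV) A = (\<integral>\<^sup>+i. indicator A i \<partial>count_space UNIV)" by simp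
    also have "\<dots> = (\<Sum>i. indicator A i)" by (rule nn_integral_count_space_nat)
    finally show ?thesis by (simp add: indicator_def of_bool_def)
  qed
  then have "(\<lambda>c. emeasure (count_space UNIV) {z\<in>S. H c z = 0})
      = (\<lambda>c. SUP k. \<Sum>i. if i \<in> grid_cell k ` {z\<in>S. H c z = 0} then 1 else 0)"
    by (subst emeasure_count_space_eq_SUP_grid_cell) simp
  then show ?thesis by simp
qed


section \<open>Two free coefficients\<close>

text \<open>The pair of real coefficients of \<open>u\<close> and \<open>v\<close> is encoded as one complex number \<open>y\<close>.\<close>

definition pencil :: "(complex \<Rightarrow> complex) \<Rightarrow> (complex \<Rightarrow> complex) \<Rightarrow> (complex \<Rightarrow> complex) \<Rightarrow> complex \<Rightarrow> complex \<Rightarrow> complex"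
  where "pencil u v r y z = of_real (Re y) * u z + of_real (Im y) * v z + r z"

text \<open>The map \<open>F\<close> of the overview, given by Cramer's rule. Where the denominator
  vanishes its value is 0, since division by 0 gives 0.\<close>

definition pencil_coeffs :: "(complex \<Rightarrow> complex) \<Rightarrow> (complex \<Rightarrow> complex) \<Rightarrow> (complex \<Rightarrow> complex) \<Rightarrow> complex \<Rightarrow> complex"
  where "pencil_coeffs u v r z =
    Complex (- Im (r z * cnj (v z)) / Im (u z * cnj (v z))) (Im (r z * cnj (u z)) / Im (u z * cnj (v z)))"

text \<open>Multiplying by \<open>cnj q\<close> and taking imaginary parts eliminates
  \<open>b\<close>; multiplying by \<open>cnj p\<close> eliminates \<open>a\<close>.\<close>

lemma real_combination_eq_0_iff:
  assumes "Im (p * cnj q) \<noteq> 0"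
  shows "of_real a * p + of_real b * q + w = 0 \<longleftrightarrow>
    a = - Im (w * cnj q) / Im (p * cnj q) \<and> b = Im (w * cnj p) / Im (p * cnj q)"
proof
  assume "of_real a * p + of_real b * q + w = 0"
  then have w: "w = - (of_real a * p + of_real b * q)" by (metis add.commute eq_neg_iff_add_eq_0)
  have "Im (w * cnj q) = - a * Im (p * cnj q)" "Im (w * cnj p) = b * Im (p * cnj q)"
    unfolding w by (simp_all add: algebra_simps)
  then show "a = - Im (w * cnj q) / Im (p * cnj q) \<and> b = Im (w * cnj p) / Im (p * cnj q)"
    using assms by simp
next
  assume "a = - Im (w * cnj q) / Im (p * cnj q) \<and> b = Im (w * cnj p) / Im (p * cnj q)"
  then have "a * Im (p * cnj q) = - Im (w * cnj q)" "b * Im (p * cnj q) = Im (w * cnj p)"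
    using assms by simp_all
  then have "Im (p * cnj q) * Re (of_real a * p + of_real b * q + w) = 0"
     "Im (p * cnj q) * Im (of_real a * p + of_real b * q + w) = 0"
    by (simp_all, algebra+)
  then have "Re (of_real a * p + of_real b * q + w) = 0 \<and> Im (of_real a * p + of_real b * q + w) = 0"
    using assms by simp
  then show "of_real a * p + of_real b * q + w = 0"
    unfolding complex_eq_iff by simp
qed

lemma pencil_eq_0_iff:
  assumes "Im (u z * cnj (v z)) \<noteq> 0"
  shows "pencil u v r y z = 0 \<longleftrightarrow> pencil_coeffs u v r z = y"
  unfolding pencil_def real_combination_eq_0_iff[OF assms]
  by (auto simp: pencil_coeffs_def complex_eq_iff)

lemma borel_measurable_cnj [measurable]: "cnj \<in> borel_measurable borel"
  by (intro borel_measurable_continuous_onI continuous_intros)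

lemma differentiable_bounded_linear_compose:
  assumes "bounded_linear L" "F differentiable at z"
  shows "(\<lambda>w. L (F w)) differentiable at z"
  using assms bounded_linear.has_derivative[OF assms(1)] unfolding differentiable_def by blast

locale entire_pencil =
  fixes u v r :: "complex \<Rightarrow> complex"
  assumes u: "u holomorphic_on UNIV" and v: "v holomorphic_on UNIV" and r: "r holomorphic_on UNIV"
begin

abbreviation "root_coeffs \<equiv> pencil_coeffs u v r"

definition "indep_set = {z. Im (u z * cnj (v z)) \<noteq> 0}"

text \<open>On \<open>indep_set\<close> this is the derivative at \<open>z\<close> of the one member
  of the pencil that vanishes at \<open>z\<close>.\<close>

definition "slope z = pencil (deriv u) (deriv v) (deriv r) (root_coeffs z) z"

text \<open>Implicit differentiation of \<open>pencil u v r (root_coeffs z) z = 0\<close> gives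
  \<open>Re (F' h) u + Im (F' h) v + slope z * h = 0\<close>, which is solved here for \<open>F' h\<close>.\<close>

definition "coeffs_deriv z h =
  Complex (- Im (slope z * h * cnj (v z)) / Im (u z * cnj (v z))) (Im (slope z * h * cnj (u z)) / Im (u z * cnj (v z)))"

lemma continuous:
  "continuous_on A u" "continuous_on A v" "continuous_on A r"
  "continuous_on A (deriv u)" "continuous_on A (deriv v)" "continuous_on A (deriv r)"
  using u v r holomorphic_deriv[OF _ open_UNIV]
  by (auto intro: continuous_on_subset[OF holomorphic_on_imp_continuous_on])

lemma deriv:
  "(u has_field_derivative deriv u z) (at z)" "(v has_field_derivative deriv v z) (at z)"
  "(r has_field_derivative deriv r z) (at z)"
  using u v r by (auto intro: holomorphic_derivI)

lemma pencil_deriv: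
  "(pencil u v r y has_field_derivative pencil (deriv u) (deriv v) (deriv r) y z) (at z)"
  unfolding pencil_def by (auto intro!: derivative_eq_intros deriv)

lemma open_indep_set: "open indep_set"
  unfolding indep_set_def by (intro open_Collect_neq continuous_intros continuous)

lemma continuous_on_coeffs: "continuous_on indep_set root_coeffs"
  unfolding pencil_coeffs_def Complex_eq indep_set_def
  by (intro continuous_intros continuous) auto

lemma continuous_on_slope: "continuous_on indep_set slope"
  unfolding slope_def pencil_def
  by (intro continuous_intros continuous continuous_on_coeffs)

lemma borel_measurable_base:
  "u \<in> borel_measurable borel" "v \<in> borel_measurable borel" "r \<in> borel_measurable borel"
  "deriv u \<in> borel_measurable borel" "deriv v \<in> borel_measurable borel" "deriv r \<in> borel_measurable borel"
  using continuous[of UNIV] by (auto intro: borel_measurable_continuous_onI)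

lemma borel_measurable_coeffs: "root_coeffs \<in> borel_measurable borel"
  unfolding pencil_coeffs_def Complex_eq using borel_measurable_base[measurable] by measurable

lemma borel_measurable_slope: "slope \<in> borel_measurable borel"
  unfolding slope_def pencil_def using borel_measurable_base[measurable] borel_measurable_coeffs[measurable]
  by measurable

text \<open>Some derivative \<open>D\<close> exists because the formula is built from differentiable
  functions. Its value comes from differentiating the map that sends \<open>w\<close> to
  \<open>pencil u v r (root_coeffs w) w\<close>, which is zero near \<open>z\<close>: uniqueness of
  derivatives gives a linear system for \<open>D h\<close>.\<close>

lemma coeffs_has_derivative:
  assumes z: "z \<in> indep_set"
  shows "(root_coeffs has_derivative coeffs_deriv z) (at z)"
proof -
  have nz: "Im (u z * cnj (v z)) \<noteq> 0" using z by (simp add: indep_set_def)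
  have dif: "u differentiable at z" "v differentiable at z" "r differentiable at z"
    using deriv[of z] by (auto simp: has_field_derivative_def differentiable_def)
  have "root_coeffs differentiable at z"
    unfolding pencil_coeffs_def Complex_eq
    by (intro differentiable_add differentiable_mult differentiable_const differentiable_divide differentiable_minus
        differentiable_bounded_linear_compose[OF bounded_linear_of_real]
        differentiable_bounded_linear_compose[OF bounded_linear_Im]
        differentiable_bounded_linear_compose[OF bounded_linear_cnj] dif nz)
  then obtain D where D: "(root_coeffs has_derivative D) (at z)" by (auto simp: differentiable_def)
  let ?\<Phi> = "\<lambda>w. pencil u v r (root_coeffs w) w"
  have "(?\<Phi> has_derivative
      (\<lambda>h. (of_real (Re (root_coeffs z)) * (deriv u z * h) + of_real (Re (D h)) * u z) +
           (of_real (Im (root_coeffs z)) * (deriv v z * h) + of_real (Im (D h)) * v z) + deriv r z * h)) (at z)"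
    unfolding pencil_def
    by (intro has_derivative_add has_derivative_mult
        bounded_linear.has_derivative[OF bounded_linear_of_real]
        bounded_linear.has_derivative[OF bounded_linear_Re]
        bounded_linear.has_derivative[OF bounded_linear_Im] D
        deriv[unfolded has_field_derivative_def])
  moreover have "(?\<Phi> has_derivative (\<lambda>h. 0)) (at z)"
  proof (rule has_derivative_transform_within_open[OF has_derivative_const open_indep_set z])
    fix w assume "w \<in> indep_set"
    then show "0 = ?\<Phi> w" using pencil_eq_0_iff[of u w v r "root_coeffs w"] by (simp add: indep_set_def)
  qed
  ultimately have "(\<lambda>h. (of_real (Re (root_coeffs z)) * (deriv u z * h) + of_real (Re (D h)) * u z) +
           (of_real (Im (root_coeffs z)) * (deriv v z * h) + of_real (Im (D h)) * v z) + deriv r z * h) = (\<lambda>h. 0)"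
    by (rule has_derivative_unique)
  from fun_cong[OF this] have "(of_real (Re (root_coeffs z)) * (deriv u z * h) + of_real (Re (D h)) * u z) +
           (of_real (Im (root_coeffs z)) * (deriv v z * h) + of_real (Im (D h)) * v z) + deriv r z * h = 0" for h .
  then have "of_real (Re (D h)) * u z + of_real (Im (D h)) * v z + slope z * h = 0" for h
    by (simp add: slope_def pencil_def algebra_simps)
  then have "D h = coeffs_deriv z h" for h
    unfolding real_combination_eq_0_iff[OF nz] by (simp add: coeffs_deriv_def complex_eq_iff)
  then have "D = coeffs_deriv z" by auto
  then show ?thesis using D by simp
qed

text \<open>Multiplication by \<open>slope z\<close> has real determinant
  \<open>(cmod (slope z))\<^sup>2\<close>, and solving for the two coefficients divides by the
  determinant of the columns \<open>u z\<close>, \<open>v z\<close>, which is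
  \<open>Im (u z * cnj (v z))\<close> up to sign. If the latter vanishes, both sides are 0 because
  division by 0 gives 0.\<close>

lemma abs_real_det_coeffs_deriv:
  "\<bar>real_det (coeffs_deriv z)\<bar> = (cmod (slope z))\<^sup>2 / \<bar>Im (u z * cnj (v z))\<bar>"
proof -
  define k where "k = Im (u z * cnj (v z))"
  have *: "real_det (coeffs_deriv z) * k\<^sup>2 = - (cmod (slope z))\<^sup>2 * k" if "k \<noteq> 0"
    using that unfolding real_det_def coeffs_deriv_def k_def[symmetric]
    by (simp add: field_simps power2_eq_square[of k]) (simp add: k_def cmod_power2, algebra)
  have "real_det (coeffs_deriv z) = - (cmod (slope z))\<^sup>2 / k"
  proof (cases "k = 0")
    case True
    have "coeffs_deriv z h = 0" for h
      unfolding coeffs_deriv_def k_def[symmetric] True by (simp add: complex_eq_iff)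
    then show ?thesis using True by (simp add: real_det_def)
  next
    case False
    then have "real_det (coeffs_deriv z) = real_det (coeffs_deriv z) * k\<^sup>2 / k\<^sup>2" by simp
    also have "\<dots> = - (cmod (slope z))\<^sup>2 * k / k\<^sup>2"
      using * False by (simp only: not_False_eq_True)
    finally show ?thesis using False by (simp add: power2_eq_square)
  qed
  then show ?thesis by (simp add: k_def abs_divide)
qed

text \<open>Two points with equal coefficients are zeros of one and the same member of the pencil.
  Near \<open>z\<close> its derivative differs from \<open>slope z\<close> by at most half of
  \<open>cmod (slope z)\<close>, so by the mean value inequality it cannot vanish at two distinct
  points.\<close>

lemma coeffs_locally_inj:
  assumes z: "z \<in> indep_set" and "slope z \<noteq> 0"
  shows "\<exists>\<delta>>0. inj_on root_coeffs (ball z \<delta>)"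
proof -
  let ?Q = "\<lambda>p. pencil (deriv u) (deriv v) (deriv r) (root_coeffs (fst p)) (snd p)"
  have "continuous_on (indep_set \<times> UNIV) ?Q"
    unfolding pencil_def
    by (intro continuous_intros continuous_on_compose2[OF continuous_on_coeffs]
        continuous_on_compose2[OF continuous(4)[of UNIV]] continuous_on_compose2[OF continuous(5)[of UNIV]]
        continuous_on_compose2[OF continuous(6)[of UNIV]]) auto
  then have "continuous (at (z, z)) ?Q"
    using z open_indep_set by (simp add: continuous_on_eq_continuous_at open_Times)
  then obtain d where d: "d > 0" "\<And>p. dist p (z, z) < d \<Longrightarrow> dist (?Q p) (slope z) < cmod (slope z) / 2"
    using assms(2) unfolding continuous_at_eps_delta slope_def by (metis fst_conv half_gt_zero snd_conv zero_less_norm_iff)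
  obtain e where e: "e > 0" "ball z e \<subseteq> indep_set" using z open_indep_set openE by blast
  define \<delta> where "\<delta> = min e (d / 2)"
  have near: "cmod (pencil (deriv u) (deriv v) (deriv r) (root_coeffs x) w - slope z) \<le> cmod (slope z) / 2"
    if "x \<in> ball z \<delta>" "w \<in> ball z \<delta>" for x w
  proof -
    have "dist (x, w) (z, z) \<le> dist x z + dist w z"
      unfolding dist_Pair_Pair by (rule sqrt_sum_squares_le_sum) auto
    then have "dist (x, w) (z, z) < d" using that by (simp add: \<delta>_def dist_commute)
    then show ?thesis using d(2)[of "(x, w)"] by (simp add: dist_norm)
  qed
  have "inj_on root_coeffs (ball z \<delta>)"
  proof (rule inj_onI)
    fix x y assume xy: "x \<in> ball z \<delta>" "y \<in> ball z \<delta>" "root_coeffs x = root_coeffs y"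
    have in_set: "x \<in> indep_set" "y \<in> indep_set" using xy e by (auto simp: \<delta>_def)
    have zero: "pencil u v r (root_coeffs x) x = 0" "pencil u v r (root_coeffs x) y = 0"
      using in_set xy(3) pencil_eq_0_iff[of u x v r] pencil_eq_0_iff[of u y v r] by (auto simp: indep_set_def)
    let ?F = "\<lambda>w. pencil u v r (root_coeffs x) w - slope z * w"
    have "cmod (?F x - ?F y) \<le> cmod (slope z) / 2 * cmod (x - y)"
    proof (rule field_differentiable_bound[OF convex_ball _ _ xy(1,2)])
      fix w assume w: "w \<in> ball z \<delta>"
      show "(?F has_field_derivative pencil (deriv u) (deriv v) (deriv r) (root_coeffs x) w - slope z) (at w within ball z \<delta>)"
        by (rule has_field_derivative_at_within) (auto intro!: derivative_eq_intros pencil_deriv)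
      show "cmod (pencil (deriv u) (deriv v) (deriv r) (root_coeffs x) w - slope z) \<le> cmod (slope z) / 2"
        using near xy(1) w by blast
    qed
    moreover have "cmod (?F x - ?F y) = cmod (slope z) * cmod (x - y)"
    proof -
      have "?F x - ?F y = - (slope z * (x - y))" by (simp add: zero algebra_simps)
      then show ?thesis by (simp only: norm_minus_cancel norm_mult)
    qed
    ultimately have "cmod (slope z) * cmod (x - y) \<le> 0" by (simp add: field_simps)
    then show "x = y" using assms(2) by (simp add: mult_le_0_iff)
  qed
  moreover have "\<delta> > 0" using d e by (simp add: \<delta>_def)
  ultimately show ?thesis by auto
qed

lemma borel_measurable_count_pencil:
  assumes "fsigma_in euclidean S"
  shows "(\<lambda>y. emeasure (count_space UNIV) {z\<in>S. pencil u v r y z = 0}) \<in> borel_measurable borel"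
proof (rule borel_measurable_count_zeros[OF assms])
  show "(\<lambda>y. cmod (pencil u v r y z)) \<in> borel_measurable borel" for z
    unfolding pencil_def by measurable
  show "continuous_on S (pencil u v r y)" for y
    unfolding pencil_def by (intro continuous_intros continuous)
qed

text \<open>On \<open>indep_set\<close> the zeros of the member with coefficients \<open>y\<close>
  are exactly the preimages of \<open>y\<close> under \<open>root_coeffs\<close>, so the area
  formula applies with the Jacobian computed above.\<close>

lemma nn_integral_count_pencil:
  fixes \<phi> :: "complex \<Rightarrow> real"
  assumes S: "fsigma_in euclidean S" "S \<subseteq> indep_set"
    and \<phi>: "integrable lborel \<phi>" "\<And>y. 0 \<le> \<phi> y"
  shows "(\<integral>\<^sup>+y. emeasure (count_space UNIV) {z\<in>S. pencil u v r y z = 0} * ennreal (\<phi> y) \<partial>lborel)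
       = (\<integral>\<^sup>+z\<in>S. ennreal ((cmod (slope z))\<^sup>2 / \<bar>Im (u z * cnj (v z))\<bar> * \<phi> (root_coeffs z)) \<partial>lborel)"
proof -
  have [measurable]: "S \<in> sets borel" "\<phi> \<in> borel_measurable borel"
    using fsigma_in_euclidean_borel[OF S(1)] \<phi>(1) by auto
  note [measurable] = borel_measurable_base borel_measurable_coeffs borel_measurable_slope
  have set_eq: "{z\<in>S. root_coeffs z = y} = {z\<in>S. pencil u v r y z = 0}" for y
    using S(2) pencil_eq_0_iff[of u _ v r y] by (auto simp: indep_set_def)
  show ?thesis
    unfolding abs_real_det_coeffs_deriv[symmetric] set_eq[symmetric]
  proof (rule area_formula_complex)
    show "(root_coeffs has_derivative coeffs_deriv x) (at x)" if "x \<in> S" for x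
      using that S(2) coeffs_has_derivative by blast
    show "\<exists>\<delta>>0. inj_on root_coeffs (ball x \<delta> \<inter> S)" if x: "x \<in> S" "real_det (coeffs_deriv x) \<noteq> 0" for x
    proof -
      have "slope x \<noteq> 0" using x(2) abs_real_det_coeffs_deriv[of x] by auto
      then obtain \<delta> where "\<delta> > 0" "inj_on root_coeffs (ball x \<delta>)"
        using coeffs_locally_inj x(1) S(2) by blast
      then show ?thesis by (auto intro!: exI[of _ \<delta>] inj_on_subset[of root_coeffs "ball x \<delta>"])
    qed
    show "(\<lambda>y. emeasure (count_space UNIV) {x \<in> S. root_coeffs x = y}) \<in> borel_measurable borel"
      unfolding set_eq by (rule borel_measurable_count_pencil[OF S(1)])
    show "(\<lambda>x. ennreal (\<bar>real_det (coeffs_deriv x)\<bar> * \<phi> (root_coeffs x)) * indicator S x) \<in> borel_measurable borel"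
      unfolding abs_real_det_coeffs_deriv by measurable
  qed (use \<phi> in auto)
qed

text \<open>At a multiple zero the slope vanishes. The set \<open>S0\<close> of such points is
  F-sigma, as the zero set of \<open>slope\<close> is relatively closed in an open set, and the area
  formula over \<open>S0\<close> has integrand 0. Positivity of \<open>\<phi>\<close> then makes the
  count vanish for almost all \<open>y\<close>.\<close>

lemma AE_pencil_simple_zeros:
  fixes \<phi> :: "complex \<Rightarrow> real"
  assumes S: "fsigma_in euclidean S" "S \<subseteq> indep_set"
    and \<phi>: "integrable lborel \<phi>" "\<And>y. 0 < \<phi> y"
  shows "AE y in lborel. \<forall>z\<in>S. pencil u v r y z = 0 \<longrightarrow> pencil (deriv u) (deriv v) (deriv r) y z \<noteq> 0"
proof -
  define S0 where "S0 = S \<inter> {z\<in>indep_set. slope z = 0}"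
  obtain T where T: "closed T" "{z\<in>indep_set. slope z = 0} = T \<inter> indep_set"
    using continuous_closedin_preimage_constant[OF continuous_on_slope, of 0]
    unfolding closedin_closed by (metis inf_commute)
  have fs: "fsigma_in euclidean S0"
  proof -
    have "fsigma_in euclidean T" using T(1) by (intro closed_imp_fsigma_in) simp
    moreover have "fsigma_in euclidean indep_set"
      using open_indep_set by (intro open_imp_fsigma_in metrizable_space_euclidean) simp
    ultimately show ?thesis unfolding S0_def T(2) using S(1) by (intro fsigma_in_Int)
  qed
  have "(\<integral>\<^sup>+y. emeasure (count_space UNIV) {z\<in>S0. pencil u v r y z = 0} * ennreal (\<phi> y) \<partial>lborel)
       = (\<integral>\<^sup>+z\<in>S0. ennreal ((cmod (slope z))\<^sup>2 / \<bar>Im (u z * cnj (v z))\<bar> * \<phi> (root_coeffs z)) \<partial>lborel)"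
    by (rule nn_integral_count_pencil[OF fs _ \<phi>(1)]) (auto simp: S0_def less_imp_le[OF \<phi>(2)])
  also have "\<dots> = (\<integral>\<^sup>+z. 0 \<partial>(lborel :: complex measure))"
    by (intro nn_integral_cong) (auto simp: S0_def indicator_def)
  finally have "(\<integral>\<^sup>+y. emeasure (count_space UNIV) {z\<in>S0. pencil u v r y z = 0} * ennreal (\<phi> y) \<partial>lborel) = 0"
    by simp
  then have "AE y in lborel. emeasure (count_space UNIV) {z\<in>S0. pencil u v r y z = 0} * ennreal (\<phi> y) = 0"
    using \<phi>(1) borel_measurable_count_pencil[OF fs]
    by (subst (asm) nn_integral_0_iff_AE) auto
  then show ?thesis
  proof eventually_elim
    case (elim y)
    then have "emeasure (count_space UNIV) {z\<in>S0. pencil u v r y z = 0} = 0"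
      using \<phi>(2)[of y] by simp
    then have empty: "{z\<in>S0. pencil u v r y z = 0} = {}"
      by (simp add: emeasure_count_space split: if_splits)
    show ?case
    proof (intro ballI impI notI)
      fix z assume z: "z \<in> S" "pencil u v r y z = 0" "pencil (deriv u) (deriv v) (deriv r) y z = 0"
      then have "z \<in> indep_set" "root_coeffs z = y"
        using S(2) pencil_eq_0_iff[of u z v r y] by (auto simp: indep_set_def)
      then have "z \<in> S0" using z by (simp add: S0_def slope_def)
      then show False using z(2) empty by auto
    qed
  qed
qed

end


section \<open>Gaussian integrals\<close>

abbreviation std_gauss :: "real measure" where
  "std_gauss \<equiv> density lborel (\<lambda>x. ennreal (std_normal_density x))"

interpretation std_gauss: prob_space std_gauss
  by (rule prob_space_normal_density) simp

interpretation std_gauss_prod: product_sigma_finite "\<lambda>_::'i. std_gauss" ..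

lemma prob_space_PiM_std_gauss: "prob_space (Pi\<^sub>M I (\<lambda>_. std_gauss))"
  by (intro prob_space_PiM std_gauss.prob_space_axioms)

lemma nn_integral_std_gauss:
  assumes "h \<in> borel_measurable borel"
  shows "(\<integral>\<^sup>+y. h y \<partial>std_gauss) = (\<integral>\<^sup>+y. ennreal (std_normal_density y) * h y \<partial>lborel)"
  using assms by (subst nn_integral_density) auto

lemma nn_integral_exp_square:
  assumes "r > 0"
  shows "(\<integral>\<^sup>+b. ennreal (exp (- r * (b + t)\<^sup>2 / 2)) \<partial>lborel) = ennreal (sqrt (2 * pi / r))"
proof -
  define \<sigma> where "\<sigma> = 1 / sqrt r"
  have \<sigma>: "\<sigma> > 0" "\<sigma>\<^sup>2 = 1 / r" using assms by (simp_all add: \<sigma>_def power_divide)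
  interpret prob_space "density lborel (\<lambda>x. ennreal (normal_density (- t) \<sigma> x))"
    by (rule prob_space_normal_density[OF \<sigma>(1)])
  have "(\<integral>\<^sup>+b. ennreal (exp (- r * (b + t)\<^sup>2 / 2)) \<partial>lborel)
      = (\<integral>\<^sup>+b. ennreal (sqrt (2 * pi / r)) * ennreal (normal_density (- t) \<sigma> b) \<partial>lborel)"
    using assms by (intro nn_integral_cong, subst ennreal_mult[symmetric])
      (auto simp: normal_density_def \<sigma>(2) mult.commute)
  also have "\<dots> = ennreal (sqrt (2 * pi / r)) * (\<integral>\<^sup>+b. ennreal (normal_density (- t) \<sigma> b) \<partial>lborel)"
    by (rule nn_integral_cmult) simp
  also have "(\<integral>\<^sup>+b. ennreal (normal_density (- t) \<sigma> b) \<partial>lborel) = 1"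
    using emeasure_space_1 by (simp add: emeasure_density)
  finally show ?thesis by simp
qed

lemma nn_integral_exp_quadratic_form:
  fixes p q r :: real
  assumes r: "r > 0" and det: "p * r - q\<^sup>2 > 0"
  shows "(\<integral>\<^sup>+y. ennreal (exp (- (p * (Re y)\<^sup>2 + 2 * q * Re y * Im y + r * (Im y)\<^sup>2) / 2)) \<partial>lborel)
    = ennreal (2 * pi / sqrt (p * r - q\<^sup>2))"
proof -
  let ?\<Delta> = "p * r - q\<^sup>2"
  \<comment> \<open>Completing the square in \<open>b\<close>; the summand \<open>+ 0\<close> gives
    the first square the shape of \<open>nn_integral_exp_square\<close> with zero shift.\<close>
  have eq: "p * a\<^sup>2 + 2 * q * a * b + r * b\<^sup>2 = ?\<Delta> / r * (a + 0)\<^sup>2 + r * (b + q * a / r)\<^sup>2" for a b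
    using r by (simp add: field_simps power2_eq_square)
  have "(\<integral>\<^sup>+y. ennreal (exp (- (p * (Re y)\<^sup>2 + 2 * q * Re y * Im y + r * (Im y)\<^sup>2) / 2)) \<partial>lborel)
    = (\<integral>\<^sup>+a. \<integral>\<^sup>+b. ennreal (exp (- (p * a\<^sup>2 + 2 * q * a * b + r * b\<^sup>2) / 2)) \<partial>lborel \<partial>lborel)"
    by (subst nn_integral_lborel_Complex) simp_all
  also have "\<dots> = (\<integral>\<^sup>+a. \<integral>\<^sup>+b. ennreal (exp (- (?\<Delta> / r) * (a + 0)\<^sup>2 / 2)) * ennreal (exp (- r * (b + q * a / r)\<^sup>2 / 2)) \<partial>lborel \<partial>lborel)"
  proof -
    have "exp (- (A * u + B * w) / 2) = exp (- A * u / 2) * exp (- B * w / 2)" for A B u w :: real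
      by (simp add: exp_add[symmetric] field_simps)
    then show ?thesis unfolding eq by (simp only: ennreal_mult exp_ge_zero)
  qed
  also have "\<dots> = (\<integral>\<^sup>+a. ennreal (exp (- (?\<Delta> / r) * (a + 0)\<^sup>2 / 2)) * ennreal (sqrt (2 * pi / r)) \<partial>lborel)"
    by (subst nn_integral_cmult) (simp_all only: nn_integral_exp_square[OF r], simp_all)
  also have "\<dots> = ennreal (sqrt (2 * pi / (?\<Delta> / r))) * ennreal (sqrt (2 * pi / r))"
    by (subst nn_integral_multc) (use r det in \<open>simp_all only: nn_integral_exp_square divide_pos_pos\<close>, simp_all)
  also have "\<dots> = ennreal (sqrt ((2 * pi / (?\<Delta> / r)) * (2 * pi / r)))"
    using r det by (simp only: real_sqrt_mult) (simp add: ennreal_mult)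
  also have "(2 * pi / (?\<Delta> / r)) * (2 * pi / r) = (2 * pi)\<^sup>2 / ?\<Delta>"
    using r det by (simp add: field_simps power2_eq_square)
  also have "sqrt ((2 * pi)\<^sup>2 / ?\<Delta>) = 2 * pi / sqrt ?\<Delta>"
    by (simp only: real_sqrt_divide real_sqrt_abs) simp
  finally show ?thesis .
qed

text \<open>Expanding the square leaves the moments 1, 0, 1 of orders 0, 1, 2 of the standard normal
  law.\<close>

lemma nn_integral_std_gauss_affine_square:
  "(\<integral>\<^sup>+y. ennreal ((cmod (w + of_real y * q))\<^sup>2) \<partial>std_gauss) = ennreal ((cmod w)\<^sup>2 + (cmod q)\<^sup>2)"
proof -
  have m0: "has_bochner_integral lborel std_normal_density 1"
    using std_normal_moment_even[of 0] by simp
  have m1: "has_bochner_integral lborel (\<lambda>x. std_normal_density x * x) 0"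
    using std_normal_moment_odd[of 0] by simp
  have m2: "has_bochner_integral lborel (\<lambda>x. std_normal_density x * x\<^sup>2) 1"
    using std_normal_moment_even[of 1] by simp
  have sq: "(cmod (w + of_real y * q))\<^sup>2 = (cmod w)\<^sup>2 + y * (2 * Re (w * cnj q)) + y\<^sup>2 * (cmod q)\<^sup>2" for y
    unfolding cmod_power2 by (simp add: algebra_simps power2_eq_square)
  have "has_bochner_integral lborel (\<lambda>y. std_normal_density y * (cmod w)\<^sup>2
      + (std_normal_density y * y) * (2 * Re (w * cnj q)) + (std_normal_density y * y\<^sup>2) * (cmod q)\<^sup>2)
      (1 * (cmod w)\<^sup>2 + 0 * (2 * Re (w * cnj q)) + 1 * (cmod q)\<^sup>2)"
    by (intro has_bochner_integral_add has_bochner_integral_mult_left m0 m1 m2)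
  then have hb: "has_bochner_integral lborel (\<lambda>y. std_normal_density y * (cmod (w + of_real y * q))\<^sup>2)
      ((cmod w)\<^sup>2 + (cmod q)\<^sup>2)"
    unfolding sq by (simp add: algebra_simps)
  have "(\<integral>\<^sup>+y. ennreal ((cmod (w + of_real y * q))\<^sup>2) \<partial>std_gauss)
     = (\<integral>\<^sup>+y. ennreal (std_normal_density y * (cmod (w + of_real y * q))\<^sup>2) \<partial>lborel)"
    by (subst nn_integral_std_gauss) (simp_all add: ennreal_mult)
  also have "\<dots> = ennreal ((cmod w)\<^sup>2 + (cmod q)\<^sup>2)"
    using hb by (subst nn_integral_eq_integral) (auto simp: has_bochner_integral_iff)
  finally show ?thesis .
qed

text \<open>The coefficients are integrated one at a time: all other terms act as the constant of an
  affine function, and each integration adds one variance.\<close>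

lemma nn_integral_PiM_std_gauss_square:
  fixes q :: "'i \<Rightarrow> complex"
  assumes "finite J"
  shows "(\<integral>\<^sup>+x. ennreal ((cmod (w + (\<Sum>i\<in>J. of_real (x i) * q i)))\<^sup>2) \<partial>Pi\<^sub>M J (\<lambda>_. std_gauss))
    = ennreal ((cmod w)\<^sup>2 + (\<Sum>i\<in>J. (cmod (q i))\<^sup>2))"
  using assms
proof (induction J arbitrary: w)
  case empty
  then show ?case
    using prob_space.emeasure_space_1[OF prob_space_PiM_std_gauss[of "{} :: 'i set"]]
    by (simp add: std_gauss_prod.nn_integral_empty)
next
  case (insert i J)
  interpret prob_space "Pi\<^sub>M J (\<lambda>_. std_gauss)" by (rule prob_space_PiM_std_gauss)
  have [measurable]: "(\<lambda>x. x l) \<in> borel_measurable (Pi\<^sub>M A (\<lambda>_. std_gauss))" if "l \<in> A" for l and A :: "'i set"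
    using measurable_component_singleton[OF that, of "\<lambda>_. std_gauss"] by simp
  have "(\<integral>\<^sup>+x. ennreal ((cmod (w + (\<Sum>l\<in>insert i J. of_real (x l) * q l)))\<^sup>2) \<partial>Pi\<^sub>M (insert i J) (\<lambda>_. std_gauss))
     = (\<integral>\<^sup>+x. \<integral>\<^sup>+y. ennreal ((cmod (w + (\<Sum>l\<in>insert i J. of_real ((x(i := y)) l) * q l)))\<^sup>2) \<partial>std_gauss \<partial>Pi\<^sub>M J (\<lambda>_. std_gauss))"
    using insert.hyps by (intro std_gauss_prod.product_nn_integral_insert) measurable
  also have "\<dots> = (\<integral>\<^sup>+x. \<integral>\<^sup>+y. ennreal ((cmod ((w + (\<Sum>l\<in>J. of_real (x l) * q l)) + of_real y * q i))\<^sup>2) \<partial>std_gauss \<partial>Pi\<^sub>M J (\<lambda>_. std_gauss))"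
  proof -
    have "(\<Sum>l\<in>insert i J. of_real ((x(i := y)) l) * q l) = of_real y * q i + (\<Sum>l\<in>J. of_real (x l) * q l)" for x y
      using insert.hyps by (simp, intro sum.cong) auto
    then show ?thesis by (simp add: ac_simps)
  qed
  also have "\<dots> = (\<integral>\<^sup>+x. ennreal ((cmod (w + (\<Sum>l\<in>J. of_real (x l) * q l)))\<^sup>2) + ennreal ((cmod (q i))\<^sup>2) \<partial>Pi\<^sub>M J (\<lambda>_. std_gauss))"
    unfolding nn_integral_std_gauss_affine_square by simp
  also have "\<dots> = (\<integral>\<^sup>+x. ennreal ((cmod (w + (\<Sum>l\<in>J. of_real (x l) * q l)))\<^sup>2) \<partial>Pi\<^sub>M J (\<lambda>_. std_gauss)) + ennreal ((cmod (q i))\<^sup>2)"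
    by (subst nn_integral_add) (auto simp: emeasure_space_1)
  also have "\<dots> = ennreal ((cmod w)\<^sup>2 + (\<Sum>l\<in>insert i J. (cmod (q l))\<^sup>2))"
    unfolding insert.IH using insert.hyps by (simp add: ennreal_plus[symmetric] sum_nonneg ac_simps del: ennreal_plus)
  finally show ?case .
qed

section \<open>Translations of the Gaussian product measure\<close>

lemma nn_integral_std_gauss_shift:
  assumes [measurable]: "h \<in> borel_measurable borel"
  shows "(\<integral>\<^sup>+y. h y \<partial>std_gauss) = (\<integral>\<^sup>+y. h (y + s) * ennreal (exp (- s * y - s\<^sup>2 / 2)) \<partial>std_gauss)"
proof -
  have dens: "std_normal_density (s + 1 * y) = std_normal_density y * exp (- s * y - s\<^sup>2 / 2)" for y
    by (simp add: std_normal_density_def exp_add[symmetric] power2_eq_square field_simps)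
  have "(\<integral>\<^sup>+y. h y \<partial>std_gauss) = (\<integral>\<^sup>+y. ennreal (std_normal_density y) * h y \<partial>lborel)"
    by (rule nn_integral_std_gauss) simp
  also have "\<dots> = (\<integral>\<^sup>+y. ennreal (std_normal_density (s + 1 * y)) * h (s + 1 * y) \<partial>lborel)"
    by (subst nn_integral_real_affine[of _ 1 s]) simp_all
  also have "\<dots> = (\<integral>\<^sup>+y. ennreal (std_normal_density y) * (h (y + s) * ennreal (exp (- s * y - s\<^sup>2 / 2))) \<partial>lborel)"
    unfolding dens by (intro nn_integral_cong) (simp add: ennreal_mult ac_simps)
  also have "\<dots> = (\<integral>\<^sup>+y. h (y + s) * ennreal (exp (- s * y - s\<^sup>2 / 2)) \<partial>std_gauss)"
    by (rule nn_integral_std_gauss[symmetric]) simp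
  finally show ?thesis .
qed

lemma sets_PiM_std_gauss [measurable_cong]: "sets (Pi\<^sub>M I (\<lambda>_. std_gauss)) = sets (Pi\<^sub>M I (\<lambda>_. borel))"
  by (intro sets_PiM_cong) auto

text \<open>Shifting one coordinate multiplies the density by an exponential, and over independent
  coordinates these factors multiply. The shifted vector is restricted to \<open>I\<close> because
  points of the product space are undefined outside \<open>I\<close>.\<close>

lemma cameron_martin_PiM:
  fixes s :: "'a \<Rightarrow> real"
  assumes "finite I" and "h \<in> borel_measurable (Pi\<^sub>M I (\<lambda>_. std_gauss))"
  shows "(\<integral>\<^sup>+x. h x \<partial>Pi\<^sub>M I (\<lambda>_. std_gauss)) =
    (\<integral>\<^sup>+x. h (\<lambda>i\<in>I. x i + s i) * ennreal (exp (- (\<Sum>i\<in>I. s i * x i) - (\<Sum>i\<in>I. (s i)\<^sup>2) / 2)) \<partial>Pi\<^sub>M I (\<lambda>_. std_gauss))"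
  using assms
proof (induction I arbitrary: h)
  case empty
  show ?case
    using prob_space.emeasure_space_1[OF prob_space_PiM_std_gauss[of "{} :: 'a set"]]
    by (simp add: std_gauss_prod.nn_integral_empty)
next
  case (insert i I)
  note [measurable] = insert.prems
  let ?g = "\<lambda>A. Pi\<^sub>M A (\<lambda>_. std_gauss)"
  \<comment> \<open>The new coordinate is shifted and integrated out first, so that the induction
    hypothesis shifts the remaining ones in \<open>H\<close>.\<close>
  define H where "H = (\<lambda>x. \<integral>\<^sup>+y. h (x(i := y + s i)) * ennreal (exp (- s i * y - (s i)\<^sup>2 / 2)) \<partial>std_gauss)"
  have [measurable]: "(\<lambda>x. x l) \<in> borel_measurable (?g A)" if "l \<in> A" for l and A
    using measurable_component_singleton[OF that, of "\<lambda>_. std_gauss"] by simp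
  have [measurable]: "(\<lambda>(x, y). x(i := y + s i)) \<in> ?g I \<Otimes>\<^sub>M std_gauss \<rightarrow>\<^sub>M ?g (insert i I)"
  proof -
    have "(\<lambda>p. (\<lambda>(x, y). x(i := y)) (fst p, snd p + s i)) \<in> ?g I \<Otimes>\<^sub>M std_gauss \<rightarrow>\<^sub>M ?g (insert i I)"
      by (rule measurable_compose[OF _ measurable_add_dim]) measurable
    then show ?thesis by (simp add: split_beta')
  qed
  have [measurable]: "(\<lambda>(x, y). h (x(i := y + s i))) \<in> borel_measurable (?g I \<Otimes>\<^sub>M std_gauss)"
    using measurable_compose[OF \<open>(\<lambda>(x, y). x(i := y + s i)) \<in> _\<close> insert.prems] by (simp add: split_beta')
  have H [measurable]: "H \<in> borel_measurable (?g I)"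
    unfolding H_def by measurable
  have hx: "(\<lambda>y. h (x(i := y))) \<in> borel_measurable borel" if "x \<in> space (?g I)" for x
    using measurable_compose[OF measurable_component_update[OF that insert.hyps(2)] insert.prems]
    by (simp add: fun_upd_def)
  have "(\<integral>\<^sup>+x. h x \<partial>?g (insert i I)) = (\<integral>\<^sup>+x. \<integral>\<^sup>+y. h (x(i := y)) \<partial>std_gauss \<partial>?g I)"
    using insert by (intro std_gauss_prod.product_nn_integral_insert) auto
  also have "\<dots> = (\<integral>\<^sup>+x. H x \<partial>?g I)"
    unfolding H_def by (intro nn_integral_cong nn_integral_std_gauss_shift hx)
  also have "\<dots> = (\<integral>\<^sup>+x. H (\<lambda>l\<in>I. x l + s l) * ennreal (exp (- (\<Sum>l\<in>I. s l * x l) - (\<Sum>l\<in>I. (s l)\<^sup>2) / 2)) \<partial>?g I)"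
    using insert.IH[OF H] .
  also have "\<dots> = (\<integral>\<^sup>+x. \<integral>\<^sup>+y. h (\<lambda>l\<in>insert i I. (x(i := y)) l + s l) *
      ennreal (exp (- (\<Sum>l\<in>insert i I. s l * (x(i := y)) l) - (\<Sum>l\<in>insert i I. (s l)\<^sup>2) / 2)) \<partial>std_gauss \<partial>?g I)"
  proof (intro nn_integral_cong)
    fix x assume x: "x \<in> space (?g I)"
    have sp: "(\<lambda>l\<in>I. x l + s l) \<in> space (?g I)" by (simp add: space_PiM)
    have up: "(\<lambda>l\<in>I. x l + s l)(i := y + s i) = (\<lambda>l\<in>insert i I. (x(i := y)) l + s l)" for y
      using insert.hyps by (auto simp: fun_eq_iff)
    have sm: "(\<Sum>l\<in>insert i I. s l * (x(i := y)) l) = s i * y + (\<Sum>l\<in>I. s l * x l)" for y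
      using insert.hyps by (simp, intro sum.cong) auto
    have "(\<lambda>y. h ((\<lambda>l\<in>I. x l + s l)(i := y + s i))) \<in> borel_measurable borel"
      using measurable_compose[OF _ hx[OF sp], of "\<lambda>y. y + s i" borel] by simp
    then have "H (\<lambda>l\<in>I. x l + s l) * ennreal (exp (- (\<Sum>l\<in>I. s l * x l) - (\<Sum>l\<in>I. (s l)\<^sup>2) / 2))
       = (\<integral>\<^sup>+y. h ((\<lambda>l\<in>I. x l + s l)(i := y + s i)) * ennreal (exp (- s i * y - (s i)\<^sup>2 / 2))
           * ennreal (exp (- (\<Sum>l\<in>I. s l * x l) - (\<Sum>l\<in>I. (s l)\<^sup>2) / 2)) \<partial>std_gauss)"
      unfolding H_def by (intro nn_integral_multc[symmetric]) simp
    also have "\<dots> = (\<integral>\<^sup>+y. h (\<lambda>l\<in>insert i I. (x(i := y)) l + s l) *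
      ennreal (exp (- (\<Sum>l\<in>insert i I. s l * (x(i := y)) l) - (\<Sum>l\<in>insert i I. (s l)\<^sup>2) / 2)) \<partial>std_gauss)"
      unfolding up sm using insert.hyps
      by (intro nn_integral_cong)
         (simp add: mult.assoc ennreal_mult[symmetric] exp_add[symmetric] add_divide_distrib algebra_simps)
    finally show "H (\<lambda>l\<in>I. x l + s l) * ennreal (exp (- (\<Sum>l\<in>I. s l * x l) - (\<Sum>l\<in>I. (s l)\<^sup>2) / 2)) = \<dots>" .
  qed
  also have "\<dots> = (\<integral>\<^sup>+x. h (\<lambda>l\<in>insert i I. x l + s l) *
      ennreal (exp (- (\<Sum>l\<in>insert i I. s l * x l) - (\<Sum>l\<in>insert i I. (s l)\<^sup>2) / 2)) \<partial>?g (insert i I))"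
  proof (rule std_gauss_prod.product_nn_integral_insert[symmetric])
    have "(\<lambda>x. \<lambda>l\<in>insert i I. x l + s l) \<in> ?g (insert i I) \<rightarrow>\<^sub>M ?g (insert i I)"
      by (intro measurable_restrict) simp
    from measurable_compose[OF this insert.prems]
    show "(\<lambda>x. h (\<lambda>l\<in>insert i I. x l + s l) * ennreal (exp (- (\<Sum>l\<in>insert i I. s l * x l) - (\<Sum>l\<in>insert i I. (s l)\<^sup>2) / 2)))
      \<in> borel_measurable (?g (insert i I))" by measurable
  qed (use insert.hyps in auto)
  finally show ?case .
qed

section \<open>Two Gaussian coordinates as one complex variable\<close>

definition gauss2 :: "complex \<Rightarrow> real" where
  "gauss2 y = std_normal_density (Re y) * std_normal_density (Im y)"

lemma gauss2_pos: "0 < gauss2 y"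
  by (simp add: gauss2_def normal_density_pos)

lemma borel_measurable_gauss2 [measurable]: "gauss2 \<in> borel_measurable borel"
  unfolding gauss2_def by measurable

lemma integrable_gauss2: "integrable lborel gauss2"
proof (rule integrableI_nonneg)
  have "(\<integral>\<^sup>+y. ennreal (std_normal_density y) \<partial>lborel) = 1"
    using std_gauss.emeasure_space_1 by (simp add: emeasure_density)
  then have "(\<integral>\<^sup>+y. ennreal (gauss2 y) \<partial>lborel) = 1"
    by (simp add: nn_integral_lborel_Complex gauss2_def ennreal_mult nn_integral_cmult)
  then show "(\<integral>\<^sup>+y. ennreal (gauss2 y) \<partial>lborel) < \<infinity>" by simp
qed (auto simp: gauss2_pos less_imp_le)

lemma gauss2_add:
  "gauss2 (y + t) = gauss2 y * exp (- (Re y * Re t + Im y * Im t) - ((Re t)\<^sup>2 + (Im t)\<^sup>2) / 2)"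
  by (simp add: gauss2_def std_normal_density_def exp_add[symmetric] power2_eq_square field_simps)

text \<open>The coordinates \<open>j\<close> and \<open>k\<close> are split off one after the other.
  Swapping their integrals puts the real part, which carries \<open>j\<close>, outside, as
  integration over the complex plane requires.\<close>

lemma nn_integral_PiM_insert2:
  assumes I: "finite I" "j \<notin> I" "k \<notin> I" "j \<noteq> k"
    and h [measurable]: "h \<in> borel_measurable (Pi\<^sub>M (insert j (insert k I)) (\<lambda>_. std_gauss))"
  shows "(\<integral>\<^sup>+x. h x \<partial>Pi\<^sub>M (insert j (insert k I)) (\<lambda>_. std_gauss)) =
    (\<integral>\<^sup>+x. \<integral>\<^sup>+y. h (x(k := Im y, j := Re y)) * ennreal (gauss2 y) \<partial>lborel \<partial>Pi\<^sub>M I (\<lambda>_. std_gauss))"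
proof -
  let ?g = "\<lambda>A. Pi\<^sub>M A (\<lambda>_. std_gauss)"
  have pair_sets: "sets (std_gauss \<Otimes>\<^sub>M std_gauss) = sets (borel \<Otimes>\<^sub>M borel)"
    by (intro sets_pair_measure_cong) auto
  have pm: "(\<lambda>p. h (x(k := snd p, j := fst p))) \<in> borel_measurable (borel \<Otimes>\<^sub>M borel)" if x: "x \<in> space (?g I)" for x
  proof -
    have a: "(\<lambda>p. x(k := snd p)) \<in> (std_gauss \<Otimes>\<^sub>M std_gauss) \<rightarrow>\<^sub>M ?g (insert k I)"
      using measurable_compose[OF measurable_snd measurable_component_update[OF x I(3)]] .
    have "(\<lambda>p. (x(k := snd p), fst p)) \<in> (std_gauss \<Otimes>\<^sub>M std_gauss) \<rightarrow>\<^sub>M (?g (insert k I) \<Otimes>\<^sub>M std_gauss)"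
      using a by measurable
    then have "(\<lambda>p. (x(k := snd p, j := fst p))) \<in> (std_gauss \<Otimes>\<^sub>M std_gauss) \<rightarrow>\<^sub>M ?g (insert j (insert k I))"
      using measurable_compose[OF _ measurable_add_dim[of j "insert k I" "\<lambda>_. std_gauss"]] by simp
    from measurable_compose[OF this h] show ?thesis
      unfolding measurable_cong_sets[OF pair_sets refl] .
  qed
  have "(\<integral>\<^sup>+x. h x \<partial>?g (insert j (insert k I))) = (\<integral>\<^sup>+x. \<integral>\<^sup>+a. h (x(j := a)) \<partial>std_gauss \<partial>?g (insert k I))"
    using I by (intro std_gauss_prod.product_nn_integral_insert h) auto
  also have "\<dots> = (\<integral>\<^sup>+x. \<integral>\<^sup>+b. \<integral>\<^sup>+a. h (x(k := b, j := a)) \<partial>std_gauss \<partial>std_gauss \<partial>?g I)"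
  proof (rule std_gauss_prod.product_nn_integral_insert)
    have "(\<lambda>(x, a). h (x(j := a))) \<in> borel_measurable (?g (insert k I) \<Otimes>\<^sub>M std_gauss)"
      using measurable_compose[OF measurable_add_dim h] by (simp add: split_beta')
    then show "(\<lambda>x. \<integral>\<^sup>+a. h (x(j := a)) \<partial>std_gauss) \<in> borel_measurable (?g (insert k I))"
      by (rule std_gauss.borel_measurable_nn_integral)
  qed (use I in auto)
  also have "\<dots> = (\<integral>\<^sup>+x. \<integral>\<^sup>+y. h (x(k := Im y, j := Re y)) * ennreal (gauss2 y) \<partial>lborel \<partial>?g I)"
  proof (rule nn_integral_cong)
    fix x assume x: "x \<in> space (?g I)"
    note [measurable] = pm[OF x]
    have hm: "(\<lambda>y. h (x(k := Im y, j := Re y))) \<in> borel_measurable borel"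
      using measurable_compose[OF _ pm[OF x], of "\<lambda>y. (Re y, Im y)" borel] by simp
    have hb: "(\<lambda>(a, b). h (x(k := b, j := a))) \<in> borel_measurable (std_gauss \<Otimes>\<^sub>M std_gauss)"
      using pm[OF x] unfolding measurable_cong_sets[OF pair_sets refl] by (simp add: split_beta')
    have hba [measurable]: "(\<lambda>b. h (x(k := b, j := a))) \<in> borel_measurable borel" for a
      using measurable_compose[OF _ pm[OF x], of "\<lambda>b. (a, b)" borel] by simp
    interpret pair_sigma_finite std_gauss std_gauss ..
    have "(\<integral>\<^sup>+b. \<integral>\<^sup>+a. h (x(k := b, j := a)) \<partial>std_gauss \<partial>std_gauss)
        = (\<integral>\<^sup>+a. \<integral>\<^sup>+b. h (x(k := b, j := a)) \<partial>std_gauss \<partial>std_gauss)"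
      using hb by (intro Fubini') simp
    also have "\<dots> = (\<integral>\<^sup>+a. ennreal (std_normal_density a) * (\<integral>\<^sup>+b. ennreal (std_normal_density b) * h (x(k := b, j := a)) \<partial>lborel) \<partial>lborel)"
      using hb by (simp add: nn_integral_std_gauss hba)
    also have "\<dots> = (\<integral>\<^sup>+a. \<integral>\<^sup>+b. h (x(k := b, j := a)) * ennreal (gauss2 (Complex a b)) \<partial>lborel \<partial>lborel)"
      by (simp add: gauss2_def ennreal_mult ac_simps flip: nn_integral_cmult)
    also have "\<dots> = (\<integral>\<^sup>+y. h (x(k := Im y, j := Re y)) * ennreal (gauss2 y) \<partial>lborel)"
      using hm by (subst nn_integral_lborel_Complex) simp_all
    finally show "(\<integral>\<^sup>+b. \<integral>\<^sup>+a. h (x(k := b, j := a)) \<partial>std_gauss \<partial>std_gauss) = \<dots>" .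
  qed
  finally show ?thesis .
qed


text \<open>The situation at one fixed \<open>z\<close>, with \<open>c i\<close> in the role of
  \<open>f i z\<close>. The real coefficient vectors whose combination of the \<open>c i\<close>
  vanishes form a subspace of codimension two, which is the graph of \<open>solution\<close> over
  the coordinates in \<open>I\<close>.\<close>

locale gaussian_kernel_slice =
  fixes I :: "'i set" and j k :: 'i and c :: "'i \<Rightarrow> complex"
  assumes I: "finite I" "j \<notin> I" "k \<notin> I" "j \<noteq> k" and indep: "Im (c j * cnj (c k)) \<noteq> 0"
begin

definition "J = insert j (insert k I)"

definition comb :: "('i \<Rightarrow> complex) \<Rightarrow> ('i \<Rightarrow> real) \<Rightarrow> complex \<Rightarrow> complex" where
  "comb d x y = of_real (Re y) * d j + of_real (Im y) * d k + (\<Sum>i\<in>I. of_real (x i) * d i)"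

definition solution :: "('i \<Rightarrow> real) \<Rightarrow> complex" where
  "solution x = Complex (- Im ((\<Sum>i\<in>I. of_real (x i) * c i) * cnj (c k)) / Im (c j * cnj (c k)))
     (Im ((\<Sum>i\<in>I. of_real (x i) * c i) * cnj (c j)) / Im (c j * cnj (c k)))"

lemma comb_eq_0_iff: "comb c x y = 0 \<longleftrightarrow> y = solution x"
  unfolding comb_def real_combination_eq_0_iff[OF indep] by (simp add: solution_def complex_eq_iff)

lemma finite_J: "finite J"
  using I by (simp add: J_def)

lemma sum_J: "sum g J = g j + g k + sum g I" for g :: "'i \<Rightarrow> 'b::comm_monoid_add"
  using I by (simp add: J_def add.assoc)

lemma comb_eq_sum: "comb d x y = (\<Sum>i\<in>J. of_real ((x(k := Im y, j := Re y)) i) * d i)"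
proof -
  have "(\<Sum>i\<in>I. of_real (x i) * d i) = (\<Sum>i\<in>I. of_real ((x(k := Im y, j := Re y)) i) * d i)"
    using I by (intro sum.cong) auto
  then show ?thesis using I by (simp add: comb_def sum_J)
qed

lemma comb_add: "comb d (\<lambda>i\<in>I. x i + s i) (y + t) = comb d x y + comb d s t"
  by (simp add: comb_def algebra_simps sum.distrib cong: sum.cong)

lemma borel_measurable_coord [measurable]:
  "i \<in> A \<Longrightarrow> (\<lambda>x. x i) \<in> borel_measurable (Pi\<^sub>M A (\<lambda>_. std_gauss))"
  using measurable_component_singleton[of i A "\<lambda>_. std_gauss"] by simp

lemma borel_measurable_solution [measurable]: "solution \<in> borel_measurable (Pi\<^sub>M I (\<lambda>_. std_gauss))"
  unfolding solution_def Complex_eq by measurable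

text \<open>The coefficient space is sliced into translates of the kernel of \<open>comb c\<close>,
  labelled by the offset \<open>y\<close> of the two free coefficients from \<open>solution\<close>.
  The vector \<open>e y\<close> has the same \<open>c\<close>-sum as this offset and is orthogonal
  to the kernel, so shifting the slice onto the kernel by \<open>e y\<close> changes the Gaussian
  weight only by \<open>exp (- (\<Sum>i\<in>J. (e y i)\<^sup>2) / 2)\<close>. Since \<open>q\<close>
  is orthogonal to \<open>e y\<close>, the value of \<open>comb q\<close> is unchanged. Thus the
  full second moment factors into kernel and offset.\<close>

lemma conditional_second_moment_mult:
  fixes q :: "'i \<Rightarrow> complex" and \<mu> :: "complex \<Rightarrow> complex"
  defines "e y i \<equiv> Re (cnj (\<mu> y) * c i)"
  assumes q: "(\<Sum>i\<in>J. q i * c i) = 0" "(\<Sum>i\<in>J. q i * cnj (c i)) = 0"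
    and \<mu> [measurable]: "\<mu> \<in> borel_measurable borel"
    and e: "\<And>y. (\<Sum>i\<in>J. of_real (e y i) * c i) = of_real (Re y) * c j + of_real (Im y) * c k"
  shows "(\<integral>\<^sup>+x. ennreal ((cmod (comb q x (solution x)))\<^sup>2 * gauss2 (solution x)) \<partial>Pi\<^sub>M I (\<lambda>_. std_gauss))
     * (\<integral>\<^sup>+y. ennreal (exp (- (\<Sum>i\<in>J. (e y i)\<^sup>2) / 2)) \<partial>lborel) = ennreal (\<Sum>i\<in>J. (cmod (q i))\<^sup>2)"
proof -
  let ?g = "Pi\<^sub>M I (\<lambda>_. std_gauss)"
  interpret g: prob_space ?g by (rule prob_space_PiM_std_gauss)
  interpret pair_sigma_finite ?g "lborel :: complex measure" ..
  \<comment> \<open>The coordinates of \<open>e y\<close> at \<open>j\<close> and \<open>k\<close>;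
    only those in \<open>I\<close> are shifted by Cameron-Martin.\<close>
  define E where "E y = Complex (e y j) (e y k)" for y
  have [measurable]: "(\<lambda>p. comb q (fst p) (solution (fst p) + snd p)) \<in> borel_measurable (?g \<Otimes>\<^sub>M borel)"
    unfolding comb_def by measurable
  have em [measurable]: "(\<lambda>y. e y i) \<in> borel_measurable borel" for i
    unfolding e_def by measurable
  have "ennreal (\<Sum>i\<in>J. (cmod (q i))\<^sup>2)
      = (\<integral>\<^sup>+x. ennreal ((cmod (0 + (\<Sum>i\<in>J. of_real (x i) * q i)))\<^sup>2) \<partial>Pi\<^sub>M J (\<lambda>_. std_gauss))"
    by (subst nn_integral_PiM_std_gauss_square[OF finite_J]) simp
  also have "\<dots> = (\<integral>\<^sup>+x. \<integral>\<^sup>+y. ennreal ((cmod (0 + (\<Sum>i\<in>J. of_real ((x(k := Im y, j := Re y)) i) * q i)))\<^sup>2)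
      * ennreal (gauss2 y) \<partial>lborel \<partial>?g)"
    unfolding J_def using I by (intro nn_integral_PiM_insert2) measurable
  also have "\<dots> = (\<integral>\<^sup>+x. \<integral>\<^sup>+y. ennreal ((cmod (comb q x y))\<^sup>2 * gauss2 y) \<partial>lborel \<partial>?g)"
    by (simp add: comb_eq_sum ennreal_mult less_imp_le[OF gauss2_pos])
  \<comment> \<open>Translation invariance in the plane: \<open>y\<close> now measures the offset
    from the kernel.\<close>
  also have "\<dots> = (\<integral>\<^sup>+x. \<integral>\<^sup>+y. ennreal ((cmod (comb q x (solution x + y)))\<^sup>2 * gauss2 (solution x + y)) \<partial>lborel \<partial>?g)"
  proof (rule nn_integral_cong)
    fix x
    have [measurable]: "comb q x \<in> borel_measurable borel" unfolding comb_def by measurable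
    have "(\<integral>\<^sup>+y. ennreal ((cmod (comb q x y))\<^sup>2 * gauss2 y) \<partial>lborel)
        = (\<integral>\<^sup>+y. ennreal ((cmod (comb q x y))\<^sup>2 * gauss2 y) \<partial>distr lborel borel ((+) (solution x)))"
      by (simp only: lborel_distr_plus)
    also have "\<dots> = (\<integral>\<^sup>+y. ennreal ((cmod (comb q x (solution x + y)))\<^sup>2 * gauss2 (solution x + y)) \<partial>lborel)"
      by (rule nn_integral_distr) measurable
    finally show "(\<integral>\<^sup>+y. ennreal ((cmod (comb q x y))\<^sup>2 * gauss2 y) \<partial>lborel) = \<dots>" .
  qed
  also have "\<dots> = (\<integral>\<^sup>+y. \<integral>\<^sup>+x. ennreal ((cmod (comb q x (solution x + y)))\<^sup>2 * gauss2 (solution x + y)) \<partial>?g \<partial>lborel)"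
    by (rule Fubini'[symmetric]) measurable
  also have "\<dots> = (\<integral>\<^sup>+y. \<integral>\<^sup>+x. ennreal ((cmod (comb q x (solution x)))\<^sup>2 * gauss2 (solution x))
      * ennreal (exp (- (\<Sum>i\<in>J. (e y i)\<^sup>2) / 2)) \<partial>?g \<partial>lborel)"
  proof (rule nn_integral_cong)
    fix y :: complex
    let ?h = "\<lambda>x. ennreal ((cmod (comb q x (solution x + y)))\<^sup>2 * gauss2 (solution x + y))"
    have "(\<integral>\<^sup>+x. ?h x \<partial>?g) = (\<integral>\<^sup>+x. ?h (\<lambda>i\<in>I. x i + e y i)
        * ennreal (exp (- (\<Sum>i\<in>I. e y i * x i) - (\<Sum>i\<in>I. (e y i)\<^sup>2) / 2)) \<partial>?g)"
      unfolding comb_def using I(1) by (intro cameron_martin_PiM) measurable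
    also have "\<dots> = (\<integral>\<^sup>+x. ennreal ((cmod (comb q x (solution x)))\<^sup>2 * gauss2 (solution x))
      * ennreal (exp (- (\<Sum>i\<in>J. (e y i)\<^sup>2) / 2)) \<partial>?g)"
    proof (rule nn_integral_cong)
      fix x :: "'i \<Rightarrow> real"
      let ?x = "\<lambda>i\<in>I. x i + e y i"
      have eE: "comb d (e y) (E y) = (\<Sum>i\<in>J. of_real (e y i) * d i)" for d
        by (simp add: comb_def E_def sum_J)
      have zero: "comb c x (solution x) = 0" by (simp add: comb_eq_0_iff)
      \<comment> \<open>\<open>e y\<close> and the offset \<open>y\<close> have equal
        \<open>c\<close>-sums, so adding their difference to a kernel vector leaves it in the
        kernel.\<close>
      have "comb c ?x (solution x + (E y - y)) = comb c x (solution x) + comb c (e y) (E y - y)"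
        by (rule comb_add)
      also have "comb c (e y) (E y - y) = comb c (e y) (E y) - (of_real (Re y) * c j + of_real (Im y) * c k)"
        by (simp add: comb_def algebra_simps)
      also have "\<dots> = 0" unfolding eE e by simp
      finally have "solution x + (E y - y) = solution ?x"
        unfolding zero by (simp only: add_0_left comb_eq_0_iff)
      then have sol: "solution ?x + y = solution x + E y" by (simp add: algebra_simps)
      \<comment> \<open>A real part is half the sum of a number and its conjugate, so
        \<open>e y\<close> is a combination of \<open>c\<close> and \<open>cnj\<close> of
        \<open>c\<close>, both orthogonal to \<open>q\<close>.\<close>
      have "(\<Sum>i\<in>J. of_real (e y i) * q i) = (\<Sum>i\<in>J. (cnj (\<mu> y) * (q i * c i) + \<mu> y * (q i * cnj (c i))) / 2)"
        by (intro sum.cong refl) (simp add: e_def complex_eq_iff algebra_simps)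
      also have "\<dots> = (cnj (\<mu> y) * (\<Sum>i\<in>J. q i * c i) + \<mu> y * (\<Sum>i\<in>J. q i * cnj (c i))) / 2"
        by (simp add: sum_divide_distrib[symmetric] sum.distrib sum_distrib_left)
      finally have qe: "comb q (e y) (E y) = 0" unfolding eE by (simp add: q)
      have cq: "comb q ?x (solution ?x + y) = comb q x (solution x)"
        unfolding sol comb_add qe by simp
      \<comment> \<open>The pairing of the kernel vector with \<open>e y\<close>; it is the linear
        term of the Gaussian exponent and vanishes.\<close>
      have "Re (solution x) * e y j + Im (solution x) * e y k + (\<Sum>i\<in>I. e y i * x i) = Re (cnj (\<mu> y) * comb c x (solution x))"
        by (simp add: comb_def e_def ring_distribs Re_sum Im_sum sum_distrib_left sum.distrib mult_ac)
      then have orth: "Re (solution x) * e y j + Im (solution x) * e y k + (\<Sum>i\<in>I. e y i * x i) = 0"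
        unfolding zero by simp
      have "exp (- (Re (solution x) * e y j + Im (solution x) * e y k) - ((e y j)\<^sup>2 + (e y k)\<^sup>2) / 2)
          * exp (- (\<Sum>i\<in>I. e y i * x i) - (\<Sum>i\<in>I. (e y i)\<^sup>2) / 2)
        = exp (- (Re (solution x) * e y j + Im (solution x) * e y k + (\<Sum>i\<in>I. e y i * x i)) - (\<Sum>i\<in>J. (e y i)\<^sup>2) / 2)"
        by (simp add: exp_add[symmetric] sum_J field_simps)
      then have ex: "exp (- (Re (solution x) * e y j + Im (solution x) * e y k) - ((e y j)\<^sup>2 + (e y k)\<^sup>2) / 2)
          * exp (- (\<Sum>i\<in>I. e y i * x i) - (\<Sum>i\<in>I. (e y i)\<^sup>2) / 2) = exp (- (\<Sum>i\<in>J. (e y i)\<^sup>2) / 2)"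
        unfolding orth by simp
      have "?h ?x * ennreal (exp (- (\<Sum>i\<in>I. e y i * x i) - (\<Sum>i\<in>I. (e y i)\<^sup>2) / 2))
        = ennreal ((cmod (comb q x (solution x)))\<^sup>2 * gauss2 (solution x)
           * (exp (- (Re (solution x) * e y j + Im (solution x) * e y k) - ((e y j)\<^sup>2 + (e y k)\<^sup>2) / 2)
          * exp (- (\<Sum>i\<in>I. e y i * x i) - (\<Sum>i\<in>I. (e y i)\<^sup>2) / 2)))"
        unfolding cq unfolding sol gauss2_add
        by (subst ennreal_mult[symmetric]) (auto simp: E_def less_imp_le[OF gauss2_pos] mult.assoc)
      also have "\<dots> = ennreal ((cmod (comb q x (solution x)))\<^sup>2 * gauss2 (solution x))
        * ennreal (exp (- (\<Sum>i\<in>J. (e y i)\<^sup>2) / 2))"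
        unfolding ex by (rule ennreal_mult) (auto simp: less_imp_le[OF gauss2_pos])
      finally show "?h ?x * ennreal (exp (- (\<Sum>i\<in>I. e y i * x i) - (\<Sum>i\<in>I. (e y i)\<^sup>2) / 2)) = \<dots>" .
    qed
    finally show "(\<integral>\<^sup>+x. ?h x \<partial>?g) = \<dots>" .
  qed
  also have "\<dots> = (\<integral>\<^sup>+y. (\<integral>\<^sup>+x. ennreal ((cmod (comb q x (solution x)))\<^sup>2 * gauss2 (solution x)) \<partial>?g)
      * ennreal (exp (- (\<Sum>i\<in>J. (e y i)\<^sup>2) / 2)) \<partial>lborel)"
    unfolding comb_def by (intro nn_integral_cong nn_integral_multc) measurable
  also have "\<dots> = (\<integral>\<^sup>+x. ennreal ((cmod (comb q x (solution x)))\<^sup>2 * gauss2 (solution x)) \<partial>?g)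
      * (\<integral>\<^sup>+y. ennreal (exp (- (\<Sum>i\<in>J. (e y i)\<^sup>2) / 2)) \<partial>lborel)"
    by (rule nn_integral_cmult) measurable
  finally show ?thesis by simp
qed

end


section \<open>The conditional second moment\<close>

text \<open>Both squares expand into double sums. With \<open>a = c i * cnj (c l)\<close> each term
  is \<open>(cmod a)\<^sup>2 - Re (a\<^sup>2)\<close>, which equals
  \<open>2 * (Im a)\<^sup>2\<close>.\<close>

lemma gram_determinant_eq:
  fixes c :: "'i \<Rightarrow> complex"
  shows "(\<Sum>i\<in>J. (cmod (c i))\<^sup>2)\<^sup>2 - (cmod (\<Sum>i\<in>J. (c i)\<^sup>2))\<^sup>2 = (\<Sum>i\<in>J. \<Sum>l\<in>J. 2 * (Im (c i * cnj (c l)))\<^sup>2)"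
proof -
  have "(cmod (\<Sum>i\<in>J. (c i)\<^sup>2))\<^sup>2 = Re ((\<Sum>i\<in>J. (c i)\<^sup>2) * cnj (\<Sum>l\<in>J. (c l)\<^sup>2))"
    by (simp only: complex_norm_square[symmetric] Re_complex_of_real)
  also have "\<dots> = (\<Sum>i\<in>J. \<Sum>l\<in>J. Re ((c i * cnj (c l))\<^sup>2))"
    by (simp only: cnj_sum sum_product Re_sum power_mult_distrib complex_cnj_power)
  finally have "(\<Sum>i\<in>J. (cmod (c i))\<^sup>2)\<^sup>2 - (cmod (\<Sum>i\<in>J. (c i)\<^sup>2))\<^sup>2
      = (\<Sum>i\<in>J. \<Sum>l\<in>J. (cmod (c i))\<^sup>2 * (cmod (c l))\<^sup>2 - Re ((c i * cnj (c l))\<^sup>2))"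
    by (simp only: power2_eq_square[of "sum _ _"] sum_product sum_subtractf)
  also have "\<dots> = (\<Sum>i\<in>J. \<Sum>l\<in>J. 2 * (Im (c i * cnj (c l)))\<^sup>2)"
  proof (intro sum.cong refl)
    fix i l
    have "(cmod (c i))\<^sup>2 * (cmod (c l))\<^sup>2 = (cmod (c i * cnj (c l)))\<^sup>2"
      by (simp add: norm_mult power_mult_distrib)
    then show "(cmod (c i))\<^sup>2 * (cmod (c l))\<^sup>2 - Re ((c i * cnj (c l))\<^sup>2) = 2 * (Im (c i * cnj (c l)))\<^sup>2"
      by (simp only: cmod_power2 Re_power2)
  qed
  finally show ?thesis .
qed

context gaussian_kernel_slice
begin

text \<open>The moment is the quotient of two quantities from
  \<open>conditional_second_moment_mult\<close>: the squared norm of the part of \<open>d\<close>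
  orthogonal to \<open>c\<close> and its conjugate, and a Gaussian integral over the plane.\<close>

lemma conditional_second_moment:
  fixes d :: "'i \<Rightarrow> complex"
  defines "A0 \<equiv> \<Sum>i\<in>J. (c i)\<^sup>2" and "A1 \<equiv> \<Sum>i\<in>J. c i * d i"
    and "B0 \<equiv> \<Sum>i\<in>J. (cmod (c i))\<^sup>2" and "B1 \<equiv> \<Sum>i\<in>J. cnj (c i) * d i"
    and "B2 \<equiv> \<Sum>i\<in>J. (cmod (d i))\<^sup>2"
  defines "D2 \<equiv> B0\<^sup>2 - (cmod A0)\<^sup>2"
  defines "\<rho> \<equiv> (B2 * D2 - B0 * ((cmod B1)\<^sup>2 + (cmod A1)\<^sup>2) + Re (A0 * B1 * cnj A1 + cnj (A0 * B1) * A1)) / (pi * (sqrt D2) ^ 3)"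
  shows "0 < D2" "0 \<le> \<rho>"
    and "(\<integral>\<^sup>+x. ennreal ((cmod (comb d x (solution x)))\<^sup>2 / \<bar>Im (c j * cnj (c k))\<bar> * gauss2 (solution x)) \<partial>Pi\<^sub>M I (\<lambda>_. std_gauss))
      = ennreal \<rho>"
proof -
  define K where "K = Im (c j * cnj (c k))"
  have K: "K \<noteq> 0" using indep by (simp add: K_def)
  show D2: "0 < D2"
  proof -
    have jk: "j \<in> J" "k \<in> J" by (simp_all add: J_def)
    have "0 < 2 * (Im (c j * cnj (c k)))\<^sup>2" using indep by simp
    also have "\<dots> \<le> (\<Sum>l\<in>J. 2 * (Im (c j * cnj (c l)))\<^sup>2)"
      using finite_J jk by (intro member_le_sum[of k J "\<lambda>l. 2 * (Im (c j * cnj (c l)))\<^sup>2"]) auto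
    also have "\<dots> \<le> (\<Sum>i\<in>J. \<Sum>l\<in>J. 2 * (Im (c i * cnj (c l)))\<^sup>2)"
      using finite_J jk by (intro member_le_sum[of j J "\<lambda>i. \<Sum>l\<in>J. 2 * (Im (c i * cnj (c l)))\<^sup>2"]) (auto intro: sum_nonneg)
    finally show ?thesis unfolding D2_def B0_def A0_def gram_determinant_eq .
  qed
  have D2c: "of_real D2 = of_real B0 * of_real B0 - A0 * cnj A0"
    unfolding D2_def of_real_diff complex_norm_square by (simp add: power2_eq_square)
  have D2nz: "complex_of_real D2 \<noteq> 0" using D2 by simp
  \<comment> \<open>Cramer's rule for the two orthogonality conditions
    \<open>B1 = \<alpha> * B0 + \<beta> * cnj A0\<close> and
    \<open>A1 = \<alpha> * A0 + \<beta> * B0\<close>, whose determinant is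
    \<open>D2\<close>.\<close>
  define \<alpha> where "\<alpha> = (of_real B0 * B1 - cnj A0 * A1) / of_real D2"
  define \<beta> where "\<beta> = (of_real B0 * A1 - A0 * B1) / of_real D2"
  have \<alpha>: "\<alpha> * of_real D2 = of_real B0 * B1 - cnj A0 * A1" and \<beta>: "\<beta> * of_real D2 = of_real B0 * A1 - A0 * B1"
    using D2nz by (simp_all add: \<alpha>_def \<beta>_def)
  define q where "q i = d i - \<alpha> * c i - \<beta> * cnj (c i)" for i
  have B0c: "(\<Sum>i\<in>J. c i * cnj (c i)) = of_real B0"
    unfolding B0_def of_real_sum complex_norm_square ..
  have B2c: "of_real B2 = (\<Sum>i\<in>J. d i * cnj (d i))"
    unfolding B2_def of_real_sum complex_norm_square ..
  have "(\<Sum>i\<in>J. q i * c i) = A1 - \<alpha> * A0 - \<beta> * (\<Sum>i\<in>J. c i * cnj (c i))"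
    by (simp add: q_def A1_def A0_def sum_subtractf sum.distrib sum_distrib_left algebra_simps power2_eq_square)
  then have "(\<Sum>i\<in>J. q i * c i) * of_real D2 = 0"
    unfolding B0c using \<alpha> \<beta> D2c by algebra
  then have q1: "(\<Sum>i\<in>J. q i * c i) = 0" using D2nz by simp
  have "(\<Sum>i\<in>J. q i * cnj (c i)) = B1 - \<alpha> * (\<Sum>i\<in>J. c i * cnj (c i)) - \<beta> * cnj A0"
    by (simp add: q_def B1_def A0_def sum_subtractf sum.distrib sum_distrib_left algebra_simps power2_eq_square)
  then have "(\<Sum>i\<in>J. q i * cnj (c i)) * of_real D2 = 0"
    unfolding B0c using \<alpha> \<beta> D2c by algebra
  then have q2: "(\<Sum>i\<in>J. q i * cnj (c i)) = 0" using D2nz by simp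
  define Q where "Q = (\<Sum>i\<in>J. (cmod (q i))\<^sup>2)"
  \<comment> \<open>By orthogonality the squared norm of \<open>q\<close> is its pairing with
    \<open>d\<close> alone; multiplied by \<open>D2\<close> it becomes the numerator of
    \<open>\<rho>\<close>.\<close>
  have "complex_of_real Q = (\<Sum>i\<in>J. q i * cnj (q i))"
    unfolding Q_def of_real_sum complex_norm_square ..
  also have "\<dots> = (\<Sum>i\<in>J. q i * cnj (d i)) - cnj \<alpha> * (\<Sum>i\<in>J. q i * cnj (c i)) - cnj \<beta> * (\<Sum>i\<in>J. q i * c i)"
    by (simp add: q_def sum_subtractf sum.distrib sum_distrib_left algebra_simps)
  also have "\<dots> = of_real B2 - \<alpha> * cnj B1 - \<beta> * cnj A1"
    unfolding q1 q2 by (simp add: q_def B2c B1_def A1_def sum_subtractf sum.distrib sum_distrib_left algebra_simps)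
  finally have "complex_of_real Q * of_real D2 = of_real B2 * of_real D2
      - of_real B0 * (B1 * cnj B1 + A1 * cnj A1) + (A0 * B1 * cnj A1 + cnj (A0 * B1) * A1)"
    using \<alpha> \<beta> unfolding complex_cnj_mult by algebra
  then have "Re (complex_of_real Q * of_real D2) = Re (of_real B2 * of_real D2
      - of_real B0 * (B1 * cnj B1 + A1 * cnj A1) + (A0 * B1 * cnj A1 + cnj (A0 * B1) * A1))" by (rule arg_cong)
  then have Q: "Q * D2 = B2 * D2 - B0 * ((cmod B1)\<^sup>2 + (cmod A1)\<^sup>2) + Re (A0 * B1 * cnj A1 + cnj (A0 * B1) * A1)"
    unfolding complex_norm_square[symmetric] of_real_add[symmetric] of_real_mult[symmetric] plus_complex.sel minus_complex.sel Re_complex_of_real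
    by simp
  have Q0: "0 \<le> Q" unfolding Q_def by (intro sum_nonneg) auto
  have \<rho>: "\<rho> = Q / (pi * sqrt D2)"
  proof -
    have "sqrt D2 ^ 3 = D2 * sqrt D2" using D2 by (simp add: power3_eq_cube)
    then show ?thesis unfolding \<rho>_def Q[symmetric] using D2 by (simp add: field_simps)
  qed
  show "0 \<le> \<rho>" unfolding \<rho> using Q0 D2 by simp
  define w where "w y = of_real (Re y) * c j + of_real (Im y) * c k" for y
  \<comment> \<open>The solution of \<open>B0 * \<mu> + A0 * cnj \<mu> = 2 * w\<close>, which says
    that \<open>e y\<close> has \<open>c\<close>-sum \<open>w y\<close>.\<close>
  define \<mu> where "\<mu> y = 2 * (of_real B0 * w y - A0 * cnj (w y)) / of_real D2" for y
  define e where "e y i = Re (cnj (\<mu> y) * c i)" for y i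
  have \<mu>: "\<mu> y * of_real D2 = 2 * (of_real B0 * w y - A0 * cnj (w y))" for y
    using D2nz by (simp add: \<mu>_def)
  have \<mu>c: "cnj (\<mu> y) * of_real D2 = 2 * (of_real B0 * cnj (w y) - cnj A0 * w y)" for y
    using arg_cong[OF \<mu>, of cnj y] by simp
  have e: "(\<Sum>i\<in>J. of_real (e y i) * c i) = w y" for y
  proof -
    have "2 * (\<Sum>i\<in>J. of_real (e y i) * c i) = (\<Sum>i\<in>J. cnj (\<mu> y) * (c i)\<^sup>2 + \<mu> y * (c i * cnj (c i)))"
      unfolding sum_distrib_left by (intro sum.cong refl) (simp add: e_def complex_eq_iff algebra_simps power2_eq_square)
    also have "\<dots> = cnj (\<mu> y) * A0 + \<mu> y * of_real B0"
      by (simp add: A0_def sum.distrib sum_distrib_left flip: B0c)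
    finally have "2 * (\<Sum>i\<in>J. of_real (e y i) * c i) * of_real D2 = 2 * w y * of_real D2"
      using \<mu>[of y] \<mu>c[of y] D2c by algebra
    then show ?thesis using D2nz by simp
  qed
  have [measurable]: "\<mu> \<in> borel_measurable borel"
    unfolding \<mu>_def w_def by measurable
  \<comment> \<open>The squared norm of \<open>e y\<close> equals
    \<open>Re (cnj (\<mu> y) * w y)\<close>. These are its coefficients as a quadratic form in
    \<open>Re y\<close> and \<open>Im y\<close>, with \<open>2 * s\<close> in the middle.\<close>
  define p s r where "p = 2 * (B0 * (cmod (c j))\<^sup>2 - Re (cnj A0 * (c j)\<^sup>2)) / D2"
    and "s = 2 * (B0 * Re (c j * cnj (c k)) - Re (cnj A0 * (c j * c k))) / D2"
    and "r = 2 * (B0 * (cmod (c k))\<^sup>2 - Re (cnj A0 * (c k)\<^sup>2)) / D2"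
  have prs: "p * D2 = 2 * (B0 * (cmod (c j))\<^sup>2 - Re (cnj A0 * (c j)\<^sup>2))"
    "s * D2 = 2 * (B0 * Re (c j * cnj (c k)) - Re (cnj A0 * (c j * c k)))"
    "r * D2 = 2 * (B0 * (cmod (c k))\<^sup>2 - Re (cnj A0 * (c k)\<^sup>2))"
    using D2 by (simp_all add: p_def s_def r_def)
  have form: "(\<Sum>i\<in>J. (e y i)\<^sup>2) = p * (Re y)\<^sup>2 + 2 * s * Re y * Im y + r * (Im y)\<^sup>2" for y
  proof -
    have "(\<Sum>i\<in>J. (e y i)\<^sup>2) = Re (cnj (\<mu> y) * (\<Sum>i\<in>J. of_real (e y i) * c i))"
      by (simp add: sum_distrib_left Re_sum e_def power2_eq_square algebra_simps)
    also have "\<dots> * D2 = Re (cnj (\<mu> y) * of_real D2 * w y)" unfolding e by (simp add: algebra_simps)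
    also have "\<dots> = (p * (Re y)\<^sup>2 + 2 * s * Re y * Im y + r * (Im y)\<^sup>2) * D2"
    proof -
      have "(p * (Re y)\<^sup>2 + 2 * s * Re y * Im y + r * (Im y)\<^sup>2) * D2
        = (p * D2) * (Re y)\<^sup>2 + 2 * (s * D2) * Re y * Im y + (r * D2) * (Im y)\<^sup>2"
        by (simp add: algebra_simps)
      then show ?thesis
        unfolding prs \<mu>c w_def cmod_power2 by (simp add: algebra_simps power2_eq_square)
    qed
    finally show ?thesis using D2 by simp
  qed
  \<comment> \<open>As a form in the coordinates of \<open>w y\<close>, \<open>D2\<close> times the
    squared norm has determinant \<open>4 * D2\<close>; passing to the coordinates of
    \<open>y\<close> multiplies this by \<open>K\<^sup>2\<close>.\<close>
  have "(p * D2) * (r * D2) - (s * D2)\<^sup>2 = 4 * (B0\<^sup>2 - (cmod A0)\<^sup>2) * K\<^sup>2"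
    unfolding prs cmod_power2 K_def by (simp add: power2_eq_square) algebra
  then have "(p * r - s\<^sup>2) * D2 * D2 = 4 * K\<^sup>2 * D2"
    unfolding D2_def[symmetric] by (simp add: algebra_simps power2_eq_square)
  then have "(p * r - s\<^sup>2) * D2 = 4 * K\<^sup>2"
    using D2 by (subst (asm) mult_right_cancel) auto
  then have det: "p * r - s\<^sup>2 = 4 * K\<^sup>2 / D2" using D2 by (simp add: field_simps)
  have r: "r > 0"
  proof -
    have "c k \<noteq> 0" using indep by auto
    have "(cmod A0)\<^sup>2 < B0\<^sup>2" using D2 by (simp add: D2_def)
    then have "cmod A0 < B0"
      by (rule power_less_imp_less_base) (auto simp: B0_def intro: sum_nonneg)
    have "Re (cnj A0 * (c k)\<^sup>2) \<le> cmod (cnj A0 * (c k)\<^sup>2)" by (rule complex_Re_le_cmod)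
    also have "\<dots> = cmod A0 * (cmod (c k))\<^sup>2" by (simp add: norm_mult norm_power)
    also have "\<dots> < B0 * (cmod (c k))\<^sup>2" using \<open>cmod A0 < B0\<close> \<open>c k \<noteq> 0\<close> by simp
    finally show ?thesis using D2 by (simp add: r_def)
  qed
  have "2 * pi / sqrt (p * r - s\<^sup>2) = pi * sqrt D2 / \<bar>K\<bar>"
    unfolding det using K D2 by (simp add: real_sqrt_divide real_sqrt_mult field_simps)
  then have gint: "(\<integral>\<^sup>+y. ennreal (exp (- (\<Sum>i\<in>J. (e y i)\<^sup>2) / 2)) \<partial>lborel) = ennreal (pi * sqrt D2 / \<bar>K\<bar>)"
    unfolding form using r det D2 K by (subst nn_integral_exp_quadratic_form) simp_all
  let ?g = "Pi\<^sub>M I (\<lambda>_. std_gauss)"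
  \<comment> \<open>On the kernel the \<open>\<alpha>\<close> and \<open>\<beta>\<close> parts of
    \<open>d\<close> contribute multiples of \<open>comb c\<close> and its conjugate, both zero
    there.\<close>
  have comb_q: "comb q x (solution x) = comb d x (solution x)" for x
  proof -
    have z: "comb c x (solution x) = 0" by (simp add: comb_eq_0_iff)
    have "comb q x y = comb d x y - \<alpha> * comb c x y - \<beta> * cnj (comb c x y)" for y
      by (simp add: comb_def q_def algebra_simps sum_subtractf sum.distrib sum_distrib_left)
    then show ?thesis by (simp add: z)
  qed
  define G where "G = (\<integral>\<^sup>+x. ennreal ((cmod (comb d x (solution x)))\<^sup>2 * gauss2 (solution x)) \<partial>?g)"
  have "G * ennreal (pi * sqrt D2 / \<bar>K\<bar>) = ennreal Q"
    using conditional_second_moment_mult[OF q1 q2 \<open>\<mu> \<in> _\<close>] e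
    unfolding e_def[symmetric] w_def[symmetric] comb_q gint G_def Q_def by simp
  \<comment> \<open>Cancelling \<open>pi * sqrt D2\<close> leaves exactly the Jacobian factor
    \<open>1 / \<bar>K\<bar>\<close>.\<close>
  then have "G * ennreal (pi * sqrt D2 / \<bar>K\<bar>) * ennreal (1 / (pi * sqrt D2)) = ennreal Q * ennreal (1 / (pi * sqrt D2))"
    by simp
  then have "G * ennreal (1 / \<bar>K\<bar>) = ennreal \<rho>"
    using D2 K Q0 by (simp add: \<rho> mult.assoc ennreal_mult[symmetric])
  moreover have "(\<integral>\<^sup>+x. ennreal ((cmod (comb d x (solution x)))\<^sup>2 / \<bar>K\<bar> * gauss2 (solution x)) \<partial>?g)
      = (\<integral>\<^sup>+x. ennreal ((cmod (comb d x (solution x)))\<^sup>2 * gauss2 (solution x)) * ennreal (1 / \<bar>K\<bar>) \<partial>?g)"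
    by (intro nn_integral_cong, subst ennreal_mult[symmetric]) (auto simp: less_imp_le[OF gauss2_pos])
  moreover have "\<dots> = G * ennreal (1 / \<bar>K\<bar>)"
    unfolding G_def comb_def by (intro nn_integral_multc) measurable
  ultimately show "(\<integral>\<^sup>+x. ennreal ((cmod (comb d x (solution x)))\<^sup>2 / \<bar>Im (c j * cnj (c k))\<bar> * gauss2 (solution x)) \<partial>?g)
      = ennreal \<rho>"
    by (simp add: K_def)
qed

end


section \<open>The expected number of zeros\<close>

lemma D\<^sub>0_eq_sqrt_sum: "D\<^sub>0 n f z = sqrt (\<Sum>i\<le>n. \<Sum>l\<le>n. 2 * (Im (f i z * cnj (f l z)))\<^sup>2)"
  unfolding D\<^sub>0_def A\<^sub>0_def B\<^sub>0_def gram_determinant_eq ..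

locale entire_family =
  fixes n :: nat and f :: "nat \<Rightarrow> complex \<Rightarrow> complex"
  assumes hol: "\<And>j. j \<le> n \<Longrightarrow> f j holomorphic_on UNIV"
begin

abbreviation "\<gamma> \<equiv> Pi\<^sub>M {..n} (\<lambda>_. std_gauss)"

definition "lin_comb x z = (\<Sum>i\<le>n. of_real (x i) * f i z)"

definition "lin_comb' x z = (\<Sum>i\<le>n. of_real (x i) * deriv (f i) z)"

definition "indep_pair j k = {z. Im (f j z * cnj (f k z)) \<noteq> 0}"

lemma deriv_f: "i \<le> n \<Longrightarrow> (f i has_field_derivative deriv (f i) z) (at z)"
  using hol by (auto intro: holomorphic_derivI)

lemma continuous_f: "i \<le> n \<Longrightarrow> continuous_on A (f i)" "i \<le> n \<Longrightarrow> continuous_on A (deriv (f i))"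
  using hol holomorphic_deriv[OF hol open_UNIV]
  by (auto intro: continuous_on_subset[OF holomorphic_on_imp_continuous_on])

lemma borel_measurable_f [measurable]:
  "i \<le> n \<Longrightarrow> f i \<in> borel_measurable borel" "i \<le> n \<Longrightarrow> deriv (f i) \<in> borel_measurable borel"
  using continuous_f[of _ UNIV] by (auto intro: borel_measurable_continuous_onI)

lemma lin_comb_deriv: "(lin_comb x has_field_derivative lin_comb' x z) (at z)"
  unfolding lin_comb_def lin_comb'_def by (auto intro!: derivative_eq_intros deriv_f sum.cong)

lemma continuous_lin_comb: "continuous_on A (lin_comb x)" "continuous_on A (lin_comb' x)"
  unfolding lin_comb_def lin_comb'_def by (auto intro!: continuous_intros continuous_f)

lemma borel_measurable_lin_comb:
  "(\<lambda>x. lin_comb x z) \<in> borel_measurable \<gamma>" "(\<lambda>x. lin_comb' x z) \<in> borel_measurable \<gamma>"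
proof -
  have [measurable]: "(\<lambda>x. x i) \<in> borel_measurable \<gamma>" if "i \<in> {..n}" for i
    using measurable_component_singleton[OF that, of "\<lambda>_. std_gauss"] by simp
  show "(\<lambda>x. lin_comb x z) \<in> borel_measurable \<gamma>" "(\<lambda>x. lin_comb' x z) \<in> borel_measurable \<gamma>"
    unfolding lin_comb_def lin_comb'_def by measurable
qed

lemma borel_measurable_count_lin_comb:
  assumes "fsigma_in euclidean S"
  shows "(\<lambda>x. emeasure (count_space UNIV) {z\<in>S. lin_comb x z = 0}) \<in> borel_measurable \<gamma>"
  by (intro borel_measurable_count_zeros[OF assms] continuous_lin_comb measurable_compose[OF borel_measurable_lin_comb(1) borel_measurable_norm])

lemma pred_ex_zero_lin_comb:
  assumes "fsigma_in euclidean S"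
  shows "Measurable.pred \<gamma> (\<lambda>x. \<exists>z\<in>S. lin_comb x z = 0)"
  by (intro pred_ex_zero_fsigma[OF assms] continuous_lin_comb measurable_compose[OF borel_measurable_lin_comb(1) borel_measurable_norm])

text \<open>A double zero is a zero of the continuous map into pairs formed by the combination and
  its derivative.\<close>

lemma pred_ex_double_zero_lin_comb:
  assumes "fsigma_in euclidean S"
  shows "Measurable.pred \<gamma> (\<lambda>x. \<exists>z\<in>S. lin_comb x z = 0 \<and> lin_comb' x z = 0)"
proof -
  note [measurable] = borel_measurable_lin_comb
  have "Measurable.pred \<gamma> (\<lambda>x. \<exists>z\<in>S. (lin_comb x z, lin_comb' x z) = 0)"
    by (rule pred_ex_zero_fsigma[OF assms]) (auto intro!: continuous_on_Pair continuous_lin_comb simp: norm_Pair)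
  then show ?thesis by (simp add: zero_prod_def)
qed

lemma open_indep_pair: "j \<le> n \<Longrightarrow> k \<le> n \<Longrightarrow> open (indep_pair j k)"
  unfolding indep_pair_def by (intro open_Collect_neq continuous_intros continuous_f)

lemma fsigma_in_open: "open U \<Longrightarrow> fsigma_in euclidean (U :: complex set)"
  by (intro open_imp_fsigma_in metrizable_space_euclidean) simp

lemma fsigma_in_indep_pair: "j \<le> n \<Longrightarrow> k \<le> n \<Longrightarrow> fsigma_in euclidean (indep_pair j k)"
  by (intro fsigma_in_open open_indep_pair)

lemma D\<^sub>0_nonzero_imp_indep_pair:
  assumes "D\<^sub>0 n f z \<noteq> 0"
  obtains j k where "j \<le> n" "k \<le> n" "z \<in> indep_pair j k"
proof -
  have "\<exists>i\<le>n. \<exists>l\<le>n. Im (f i z * cnj (f l z)) \<noteq> 0"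
  proof (rule ccontr)
    assume "\<not> ?thesis"
    then have "(\<Sum>i\<le>n. \<Sum>l\<le>n. 2 * (Im (f i z * cnj (f l z)))\<^sup>2) = 0"
      by (intro sum.neutral ballI) (auto intro!: sum.neutral)
    then show False using assms by (simp add: D\<^sub>0_eq_sqrt_sum)
  qed
  then show ?thesis using that by (auto simp: indep_pair_def)
qed

section \<open>Conditioning on all coefficients but two\<close>

context
  fixes j k :: nat
  assumes jk: "j \<le> n" "k \<le> n" "j \<noteq> k"
begin

definition "I = {..n} - {j, k}"

abbreviation "rest x z \<equiv> \<Sum>i\<in>I. of_real (x i) * f i z"

lemma index_split: "finite I" "j \<notin> I" "k \<notin> I" "insert j (insert k I) = {..n}"
  using jk by (auto simp: I_def)

lemma I_le: "i \<in> I \<Longrightarrow> i \<le> n"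
  by (auto simp: I_def)

lemma sum_split: "(\<Sum>i\<le>n. g i) = g j + g k + sum g I" for g :: "nat \<Rightarrow> complex"
  using index_split jk(3) by (simp add: add.assoc flip: index_split(4))

lemma entire_pencil_rest: "entire_pencil (f j) (f k) (rest x)"
  using jk by unfold_locales (auto intro!: holomorphic_intros hol I_le)

lemma deriv_rest: "deriv (rest x) z = (\<Sum>i\<in>I. of_real (x i) * deriv (f i) z)"
  by (rule DERIV_imp_deriv) (auto intro!: derivative_eq_intros deriv_f I_le sum.cong)

lemma lin_comb_upd:
  "lin_comb (x(k := Im y, j := Re y)) z = pencil (f j) (f k) (rest x) y z"
  "lin_comb' (x(k := Im y, j := Re y)) z = pencil (deriv (f j)) (deriv (f k)) (deriv (rest x)) y z"
  using index_split jk(3) unfolding lin_comb_def lin_comb'_def pencil_def deriv_rest sum_split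
  by (auto intro!: arg_cong2[of _ _ _ _ "(+)"] sum.cong)

lemma gaussian_kernel_slice_indep:
  "z \<in> indep_pair j k \<Longrightarrow> gaussian_kernel_slice I j k (\<lambda>i. f i z)"
  using index_split jk by unfold_locales (auto simp: indep_pair_def)

text \<open>At fixed \<open>z\<close> the pencil is a Gaussian kernel slice:
  \<open>pencil_coeffs\<close> becomes \<open>solution\<close> and the slope becomes
  \<open>comb\<close> of the derivatives. What is integrated over the remaining coefficients is the
  Jacobian times the density of the two free ones.\<close>

lemma nn_integral_conditional:
  assumes z: "z \<in> indep_pair j k"
  shows "D\<^sub>0 n f z > 0" "0 \<le> zero_density n f z"
    and "(\<integral>\<^sup>+x. ennreal ((cmod (entire_pencil.slope (f j) (f k) (rest x) z))\<^sup>2 / \<bar>Im (f j z * cnj (f k z))\<bar>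
        * gauss2 (pencil_coeffs (f j) (f k) (rest x) z)) \<partial>Pi\<^sub>M I (\<lambda>_. std_gauss)) = ennreal (zero_density n f z)"
proof -
  interpret gaussian_kernel_slice I j k "\<lambda>i. f i z" by (rule gaussian_kernel_slice_indep[OF z])
  have J: "J = {..n}" unfolding J_def by (rule index_split(4))
  have D2: "0 < (B\<^sub>0 n f z)\<^sup>2 - (cmod (A\<^sub>0 n f z))\<^sup>2"
    using conditional_second_moment(1) by (simp add: J B\<^sub>0_def A\<^sub>0_def)
  then show "D\<^sub>0 n f z > 0" by (simp add: D\<^sub>0_def)
  have dens: "(B\<^sub>2 n f z * ((B\<^sub>0 n f z)\<^sup>2 - (cmod (A\<^sub>0 n f z))\<^sup>2)
      - B\<^sub>0 n f z * ((cmod (B\<^sub>1 n f z))\<^sup>2 + (cmod (A\<^sub>1 n f z))\<^sup>2)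
      + Re (A\<^sub>0 n f z * B\<^sub>1 n f z * cnj (A\<^sub>1 n f z) + cnj (A\<^sub>0 n f z * B\<^sub>1 n f z) * A\<^sub>1 n f z))
     / (pi * (sqrt ((B\<^sub>0 n f z)\<^sup>2 - (cmod (A\<^sub>0 n f z))\<^sup>2)) ^ 3) = zero_density n f z"
    using D2 unfolding zero_density_def D\<^sub>0_def by simp
  have sol: "pencil_coeffs (f j) (f k) (rest x) z = solution x" for x
    by (simp add: pencil_coeffs_def solution_def)
  have slope: "entire_pencil.slope (f j) (f k) (rest x) z = comb (\<lambda>i. deriv (f i) z) x (solution x)" for x
    unfolding entire_pencil.slope_def[OF entire_pencil_rest] sol pencil_def comb_def deriv_rest ..
  note moment = conditional_second_moment(2,3)[of "\<lambda>i. deriv (f i) z", unfolded J,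
    folded A\<^sub>0_def A\<^sub>1_def B\<^sub>0_def B\<^sub>1_def B\<^sub>2_def, unfolded dens]
  show "0 \<le> zero_density n f z" by (rule moment(1))
  show "(\<integral>\<^sup>+x. ennreal ((cmod (entire_pencil.slope (f j) (f k) (rest x) z))\<^sup>2 / \<bar>Im (f j z * cnj (f k z))\<bar>
        * gauss2 (pencil_coeffs (f j) (f k) (rest x) z)) \<partial>Pi\<^sub>M I (\<lambda>_. std_gauss)) = ennreal (zero_density n f z)"
    unfolding slope sol by (rule moment(2))
qed

text \<open>For fixed remaining coefficients the area formula turns the count into an integral over
  \<open>z\<close>. After exchanging the integrals, the inner one is the conditional moment at
  \<open>z\<close>.\<close>

lemma nn_integral_count_lin_comb:
  assumes S: "fsigma_in euclidean S" "S \<subseteq> indep_pair j k"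
  shows "(\<integral>\<^sup>+x. emeasure (count_space UNIV) {z\<in>S. lin_comb x z = 0} \<partial>\<gamma>)
       = (\<integral>\<^sup>+z\<in>S. ennreal (zero_density n f z) \<partial>lborel)"
proof -
  let ?g = "Pi\<^sub>M I (\<lambda>_. std_gauss)"
  interpret g: prob_space ?g by (rule prob_space_PiM_std_gauss)
  interpret pair_sigma_finite ?g "lborel :: complex measure" ..
  have [measurable]: "S \<in> sets borel" by (rule fsigma_in_euclidean_borel[OF S(1)])
  have coord [measurable]: "(\<lambda>x. x i) \<in> borel_measurable ?g" if "i \<in> I" for i
    using measurable_component_singleton[OF that, of "\<lambda>_. std_gauss"] by simp
  define W where "W x z = ennreal ((cmod (entire_pencil.slope (f j) (f k) (rest x) z))\<^sup>2
      / \<bar>Im (f j z * cnj (f k z))\<bar> * gauss2 (pencil_coeffs (f j) (f k) (rest x) z))" for x z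
  note [measurable] = borel_measurable_f[OF jk(1)] borel_measurable_f[OF jk(2)]
  have rest_m [measurable]: "(\<lambda>p. rest (fst p) (snd p)) \<in> borel_measurable (?g \<Otimes>\<^sub>M borel)"
    "(\<lambda>p. \<Sum>i\<in>I. of_real (fst p i) * deriv (f i) (snd p)) \<in> borel_measurable (?g \<Otimes>\<^sub>M borel)"
  proof -
    have [measurable]: "(\<lambda>p. f i (snd p)) \<in> borel_measurable (?g \<Otimes>\<^sub>M borel)"
      "(\<lambda>p. deriv (f i) (snd p)) \<in> borel_measurable (?g \<Otimes>\<^sub>M borel)"
      "(\<lambda>p. fst p i) \<in> borel_measurable (?g \<Otimes>\<^sub>M borel)" if "i \<in> I" for i
      using borel_measurable_f[OF I_le[OF that]] coord[OF that] by measurable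
    show "(\<lambda>p. rest (fst p) (snd p)) \<in> borel_measurable (?g \<Otimes>\<^sub>M borel)"
      "(\<lambda>p. \<Sum>i\<in>I. of_real (fst p i) * deriv (f i) (snd p)) \<in> borel_measurable (?g \<Otimes>\<^sub>M borel)"
      by measurable
  qed
  have [measurable]: "(\<lambda>p. pencil_coeffs (f j) (f k) (rest (fst p)) (snd p)) \<in> borel_measurable (?g \<Otimes>\<^sub>M borel)"
    unfolding pencil_coeffs_def Complex_eq by measurable
  have W [measurable]: "(\<lambda>p. W (fst p) (snd p)) \<in> borel_measurable (?g \<Otimes>\<^sub>M borel)"
    unfolding W_def entire_pencil.slope_def[OF entire_pencil_rest] pencil_def deriv_rest by measurable
  have "(\<integral>\<^sup>+x. emeasure (count_space UNIV) {z\<in>S. lin_comb x z = 0} \<partial>\<gamma>)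
     = (\<integral>\<^sup>+x. emeasure (count_space UNIV) {z\<in>S. lin_comb x z = 0} \<partial>Pi\<^sub>M (insert j (insert k I)) (\<lambda>_. std_gauss))"
    by (simp only: index_split(4))
  also have "\<dots> = (\<integral>\<^sup>+x. \<integral>\<^sup>+y. emeasure (count_space UNIV) {z\<in>S. lin_comb (x(k := Im y, j := Re y)) z = 0}
      * ennreal (gauss2 y) \<partial>lborel \<partial>?g)"
    by (rule nn_integral_PiM_insert2)
       (use index_split jk borel_measurable_count_lin_comb[OF S(1)] in \<open>simp_all only: index_split(4) not_False_eq_True\<close>)
  also have "\<dots> = (\<integral>\<^sup>+x. \<integral>\<^sup>+z. W x z * indicator S z \<partial>lborel \<partial>?g)"
  proof (rule nn_integral_cong)
    fix x
    interpret entire_pencil "f j" "f k" "rest x" by (rule entire_pencil_rest)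
    show "(\<integral>\<^sup>+y. emeasure (count_space UNIV) {z\<in>S. lin_comb (x(k := Im y, j := Re y)) z = 0}
      * ennreal (gauss2 y) \<partial>lborel) = (\<integral>\<^sup>+z. W x z * indicator S z \<partial>lborel)"
      unfolding lin_comb_upd W_def using S
      by (intro nn_integral_count_pencil integrable_gauss2 less_imp_le[OF gauss2_pos])
         (auto simp: indep_set_def indep_pair_def)
  qed
  also have "\<dots> = (\<integral>\<^sup>+z. \<integral>\<^sup>+x. W x z * indicator S z \<partial>?g \<partial>lborel)"
    by (rule Fubini'[symmetric]) (simp add: split_beta')
  also have "\<dots> = (\<integral>\<^sup>+z\<in>S. ennreal (zero_density n f z) \<partial>lborel)"
  proof (rule nn_integral_cong)
    fix z
    show "(\<integral>\<^sup>+x. W x z * indicator S z \<partial>?g) = ennreal (zero_density n f z) * indicator S z"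
      using nn_integral_conditional(3)[of z] S(2) by (cases "z \<in> S") (auto simp: W_def)
  qed
  finally show ?thesis .
qed

text \<open>For any remaining coefficients, almost every choice of the two free ones avoids double
  zeros. The exceptional event is measurable, so integrating its indicator slice by slice shows it
  to be null.\<close>

lemma AE_simple_zeros_indep_pair:
  "AE x in \<gamma>. \<forall>z\<in>indep_pair j k. lin_comb x z = 0 \<longrightarrow> lin_comb' x z \<noteq> 0"
proof -
  let ?g = "Pi\<^sub>M I (\<lambda>_. std_gauss)"
  define Z where "Z = (\<lambda>x. \<exists>z\<in>indep_pair j k. lin_comb x z = 0 \<and> lin_comb' x z = 0)"
  have Zm [measurable]: "Measurable.pred \<gamma> Z"
    unfolding Z_def using jk by (intro pred_ex_double_zero_lin_comb fsigma_in_indep_pair)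
  have "(\<integral>\<^sup>+x. indicator {x. Z x} x \<partial>\<gamma>) = (\<integral>\<^sup>+x. indicator {x. Z x} x \<partial>Pi\<^sub>M (insert j (insert k I)) (\<lambda>_. std_gauss))"
    by (simp only: index_split(4))
  also have "\<dots> = (\<integral>\<^sup>+x. \<integral>\<^sup>+y. indicator {x. Z x} (x(k := Im y, j := Re y)) * ennreal (gauss2 y) \<partial>lborel \<partial>?g)"
  proof (rule nn_integral_PiM_insert2)
    show "indicator {x. Z x} \<in> borel_measurable (Pi\<^sub>M (insert j (insert k I)) (\<lambda>_. std_gauss))"
      unfolding index_split(4) by measurable
  qed (use index_split jk in auto)
  also have "\<dots> = (\<integral>\<^sup>+x. 0 \<partial>?g)"
  proof (rule nn_integral_cong)
    fix x
    interpret entire_pencil "f j" "f k" "rest x" by (rule entire_pencil_rest)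
    have "AE y in lborel. \<forall>z\<in>indep_pair j k. pencil (f j) (f k) (rest x) y z = 0 \<longrightarrow>
        pencil (deriv (f j)) (deriv (f k)) (deriv (rest x)) y z \<noteq> 0"
      using jk by (intro AE_pencil_simple_zeros[OF _ _ integrable_gauss2 gauss2_pos] fsigma_in_indep_pair)
         (auto simp: indep_set_def indep_pair_def)
    then have "AE y in lborel. indicator {x. Z x} (x(k := Im y, j := Re y)) * ennreal (gauss2 y) = 0"
      by eventually_elim (auto simp: Z_def lin_comb_upd)
    then have "(\<integral>\<^sup>+y. indicator {x. Z x} (x(k := Im y, j := Re y)) * ennreal (gauss2 y) \<partial>lborel) = (\<integral>\<^sup>+y. 0 \<partial>(lborel :: complex measure))"
      by (rule nn_integral_cong_AE)
    then show "(\<integral>\<^sup>+y. indicator {x. Z x} (x(k := Im y, j := Re y)) * ennreal (gauss2 y) \<partial>lborel) = 0"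
      by simp
  qed
  finally have "(\<integral>\<^sup>+x. indicator {x. Z x} x \<partial>\<gamma>) = 0" by simp
  then have "AE x in \<gamma>. indicator {x. Z x} x = (0 :: ennreal)"
    by (subst (asm) nn_integral_0_iff_AE) auto
  then show ?thesis by eventually_elim (auto simp: Z_def indicator_def split: if_splits)
qed

end

section \<open>Null sets of the plane almost surely contain no zero\<close>

lemma continuous_on_zero_density:
  assumes "j \<le> n" "k \<le> n" "j \<noteq> k"
  shows "continuous_on (indep_pair j k) (zero_density n f)"
proof -
  have "D\<^sub>0 n f z \<noteq> 0" if "z \<in> indep_pair j k" for z
    using nn_integral_conditional(1)[OF assms that] by simp
  then show ?thesis
    unfolding zero_density_def D\<^sub>0_def A\<^sub>0_def A\<^sub>1_def B\<^sub>0_def B\<^sub>1_def B\<^sub>2_def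
    by (intro continuous_intros continuous_f) auto
qed

lemma borel_measurable_zero_density [measurable]: "zero_density n f \<in> borel_measurable borel"
proof -
  have [measurable]: "f i \<in> borel_measurable borel" "deriv (f i) \<in> borel_measurable borel" if "i \<in> {..n}" for i
    using borel_measurable_f that by auto
  show ?thesis
    unfolding zero_density_def D\<^sub>0_def A\<^sub>0_def A\<^sub>1_def B\<^sub>0_def B\<^sub>1_def B\<^sub>2_def by measurable
qed

text \<open>Markov's inequality: a nonempty zero set has count at least 1.\<close>

lemma emeasure_ex_zero_le:
  assumes "fsigma_in euclidean S"
  shows "emeasure \<gamma> {x\<in>space \<gamma>. \<exists>z\<in>S. lin_comb x z = 0}
    \<le> (\<integral>\<^sup>+x. emeasure (count_space UNIV) {z\<in>S. lin_comb x z = 0} \<partial>\<gamma>)"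
proof -
  have "emeasure \<gamma> {x\<in>space \<gamma>. \<exists>z\<in>S. lin_comb x z = 0}
      = (\<integral>\<^sup>+x. indicator {x\<in>space \<gamma>. \<exists>z\<in>S. lin_comb x z = 0} x \<partial>\<gamma>)"
    using pred_ex_zero_lin_comb[OF assms] by (intro nn_integral_indicator[symmetric]) simp
  also have "\<dots> \<le> (\<integral>\<^sup>+x. emeasure (count_space UNIV) {z\<in>S. lin_comb x z = 0} \<partial>\<gamma>)"
  proof (rule nn_integral_mono)
    fix x
    show "indicator {x\<in>space \<gamma>. \<exists>z\<in>S. lin_comb x z = 0} x \<le> emeasure (count_space UNIV) {z\<in>S. lin_comb x z = 0}"
    proof (cases "\<exists>z\<in>S. lin_comb x z = 0")
      case True
      then obtain z where "z \<in> S" "lin_comb x z = 0" by auto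
      then have "emeasure (count_space UNIV) {z} \<le> emeasure (count_space UNIV) {z\<in>S. lin_comb x z = 0}"
        by (intro emeasure_mono) auto
      then have "1 \<le> emeasure (count_space UNIV) {z\<in>S. lin_comb x z = 0}" by simp
      then show ?thesis by (auto simp: indicator_def)
    qed (auto simp: indicator_def)
  qed
  finally show ?thesis .
qed

text \<open>Outer regularity encloses \<open>T\<close> in open sets \<open>U m\<close> of measure at
  most \<open>1 / (m + 1)\<close>. By continuity the density stays below \<open>b\<close> on an open
  neighbourhood \<open>V\<close> of \<open>T\<close>, so the expected count in
  \<open>U m \<inter> V\<close> is at most \<open>b / (m + 1)\<close>. The event of a zero in
  \<open>T\<close> need not be measurable, but it lies in the measurable null set of outcomes with
  zeros in all \<open>U m \<inter> V\<close>.\<close>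

lemma AE_no_zero_bounded_density:
  fixes b :: nat
  assumes jk: "j \<le> n" "k \<le> n" "j \<noteq> k"
    and T: "T \<in> null_sets lebesgue" "T \<subseteq> indep_pair j k" "\<And>z. z \<in> T \<Longrightarrow> zero_density n f z < real b"
  shows "AE x in \<gamma>. \<forall>z\<in>T. lin_comb x z \<noteq> 0"
proof -
  define V where "V = indep_pair j k \<inter> zero_density n f -` {..<real b}"
  have V: "open V" unfolding V_def
    by (intro continuous_open_preimage continuous_on_zero_density open_indep_pair jk) simp
  have "\<exists>U. open U \<and> T \<subseteq> U \<and> emeasure lborel U \<le> ennreal (1 / real (Suc m))" for m
  proof -
    have "T \<in> sets lebesgue" using T(1) by auto
    then obtain U where U: "open U" "T \<subseteq> U" "U - T \<in> lmeasurable" "emeasure lebesgue (U - T) < ennreal (1 / real (Suc m))"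
      by (rule sets_lebesgue_outer_open[where e = "1 / real (Suc m)"]) auto
    have "emeasure lborel U = emeasure lebesgue ((U - T) \<union> T)"
      using U(1,2) by (simp add: Un_absorb2 emeasure_completion)
    also have "\<dots> = emeasure lebesgue (U - T)"
      using T(1) U(3) by (intro emeasure_Un_null_set) auto
    finally show ?thesis using U by (intro exI[of _ U]) auto
  qed
  then obtain U where U: "\<And>m::nat. open (U m)" "\<And>m. T \<subseteq> U m" "\<And>m. emeasure lborel (U m) \<le> ennreal (1 / real (Suc m))"
    by metis
  define E where "E m = {x\<in>space \<gamma>. \<exists>z\<in>U m \<inter> V. lin_comb x z = 0}" for m
  have fs: "fsigma_in euclidean (U m \<inter> V)" for m
    using U(1) V by (intro fsigma_in_open open_Int)
  have E [measurable]: "E m \<in> sets \<gamma>" for m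
    unfolding E_def using pred_ex_zero_lin_comb[OF fs] by simp
  have E_le: "emeasure \<gamma> (E m) \<le> ennreal (real b * (1 / real (Suc m)))" for m
  proof -
    have "emeasure \<gamma> (E m) \<le> (\<integral>\<^sup>+z\<in>U m \<inter> V. ennreal (zero_density n f z) \<partial>lborel)"
    proof -
      have "U m \<inter> V \<subseteq> indep_pair j k" by (auto simp: V_def)
      then show ?thesis
        unfolding E_def using emeasure_ex_zero_le[OF fs[of m]] nn_integral_count_lin_comb[OF jk fs[of m]] by simp
    qed
    also have "\<dots> \<le> (\<integral>\<^sup>+z. ennreal (real b) * indicator (U m) z \<partial>lborel)"
      by (intro nn_integral_mono) (auto simp: V_def indicator_def intro!: ennreal_leI)
    also have "\<dots> = ennreal (real b) * emeasure lborel (U m)"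
      using U(1)[of m] by (intro nn_integral_cmult_indicator) simp
    also have "\<dots> \<le> ennreal (real b) * ennreal (1 / real (Suc m))"
      by (intro mult_left_mono U(3)) simp
    finally show ?thesis by (subst ennreal_mult) auto
  qed
  have eps: "emeasure \<gamma> (\<Inter>m. E m) \<le> 0 + ennreal e" if "e > 0" for e
  proof -
    obtain m :: nat where m: "real b / e < real m" using reals_Archimedean2 by blast
    have "real b * (1 / real (Suc m)) \<le> e"
    proof -
      have "real b < e * real m" using m that by (simp add: field_simps)
      also have "\<dots> \<le> e * real (Suc m)" using that by simp
      finally show ?thesis by (simp add: field_simps)
    qed
    have "emeasure \<gamma> (\<Inter>m. E m) \<le> emeasure \<gamma> (E m)"
      by (intro emeasure_mono) auto
    also have "\<dots> \<le> ennreal (real b * (1 / real (Suc m)))" by (rule E_le)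
    also have "\<dots> \<le> ennreal e" using \<open>real b * (1 / real (Suc m)) \<le> e\<close> by (rule ennreal_leI)
    finally show ?thesis by simp
  qed
  have "emeasure \<gamma> (\<Inter>m. E m) \<le> 0" by (rule ennreal_le_epsilon) (rule eps)
  then have "emeasure \<gamma> (\<Inter>m. E m) = 0" by (simp only: le_zero_eq)
  moreover have "(\<Inter>m. E m) \<in> sets \<gamma>" by (intro sets.countable_INT) (use E in blast)+
  ultimately have "(\<Inter>m. E m) \<in> null_sets \<gamma>" by (rule null_setsI)
  moreover have "{x\<in>space \<gamma>. \<not> (\<forall>z\<in>T. lin_comb x z \<noteq> 0)} \<subseteq> (\<Inter>m. E m)"
  proof (rule subsetI, rule INT_I)
    fix x m assume "x \<in> {x\<in>space \<gamma>. \<not> (\<forall>z\<in>T. lin_comb x z \<noteq> 0)}"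
    then obtain z where x: "x \<in> space \<gamma>" "lin_comb x z = 0" and z: "z \<in> T" by blast
    have "z \<in> U m" "z \<in> indep_pair j k" using T(2) U(2) z by blast+
    moreover have "zero_density n f z < real b" by (rule T(3)[OF z])
    ultimately have "z \<in> U m \<inter> V" unfolding V_def by simp
    then show "x \<in> E m" unfolding E_def using x by blast
  qed
  ultimately show ?thesis by (rule AE_I')
qed

text \<open>\<open>T\<close> is the union over \<open>b\<close> of its parts with density below
  \<open>b\<close>, and countably many almost sure statements combine.\<close>

lemma AE_no_zero_null_set:
  assumes jk: "j \<le> n" "k \<le> n" "j \<noteq> k"
    and T: "T \<in> null_sets lebesgue" "T \<subseteq> indep_pair j k"
  shows "AE x in \<gamma>. \<forall>z\<in>T. lin_comb x z \<noteq> 0"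
proof -
  have "AE x in \<gamma>. \<forall>z\<in>T \<inter> {z. zero_density n f z < real b}. lin_comb x z \<noteq> 0" for b :: nat
    using T by (intro AE_no_zero_bounded_density[OF jk]) (auto intro: null_sets_completion_subset[of _ T])
  then have "AE x in \<gamma>. \<forall>b::nat. \<forall>z\<in>T \<inter> {z. zero_density n f z < real b}. lin_comb x z \<noteq> 0"
    by (simp add: AE_all_countable)
  then show ?thesis
    by eventually_elim (use reals_Archimedean2 in blast)
qed

text \<open>\<open>\<Omega>\<close> is cut into disjoint Lebesgue sets, each inside one
  \<open>indep_pair\<close> and each an F-sigma set up to a null set. Counting is measurable on the
  F-sigma parts and the null parts almost surely contain no zero. The count itself is therefore only
  almost surely equal to a measurable function, which is why \<open>g\<close> is supplied.\<close>

theorem expected_zero_count: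
  assumes \<Omega>: "\<Omega> \<in> sets lebesgue" "\<Omega> \<subseteq> {z. D\<^sub>0 n f z \<noteq> 0}"
  obtains g where "g \<in> borel_measurable \<gamma>"
    and "AE x in \<gamma>. emeasure (count_space UNIV) {z\<in>\<Omega>. lin_comb x z = 0} = g x"
    and "(\<integral>\<^sup>+x. g x \<partial>\<gamma>) = (\<integral>\<^sup>+z\<in>\<Omega>. ennreal (zero_density n f z) \<partial>lebesgue)"
    and "AE x in \<gamma>. \<forall>z\<in>\<Omega>. lin_comb x z = 0 \<longrightarrow> lin_comb' x z \<noteq> 0"
proof -
  define good where "good p \<longleftrightarrow> fst p \<le> n \<and> snd p \<le> n \<and> fst p \<noteq> snd p" for p :: "nat \<times> nat"
  \<comment> \<open>Pairs of indices are enumerated by \<open>prod_decode\<close>; inadmissible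
    pairs get the empty set, so the family is indexed by all naturals.\<close>
  define U where "U i = (if good (prod_decode i) then indep_pair (fst (prod_decode i)) (snd (prod_decode i)) else {})" for i
  have U_open: "open (U i)" for i
    by (auto simp: U_def good_def intro: open_indep_pair)
  have U_cover: "\<Omega> \<subseteq> (\<Union>i. U i)"
  proof
    fix z assume "z \<in> \<Omega>"
    then have "D\<^sub>0 n f z \<noteq> 0" using \<Omega>(2) by auto
    then obtain j k where jk: "j \<le> n" "k \<le> n" "z \<in> indep_pair j k" by (rule D\<^sub>0_nonzero_imp_indep_pair)
    then have "j \<noteq> k" by (auto simp: indep_pair_def)
    then have "z \<in> U (prod_encode (j, k))" using jk by (simp add: U_def good_def)
    then show "z \<in> (\<Union>i. U i)" by auto
  qed
  define P where "P = disjointed (\<lambda>i. \<Omega> \<inter> U i)"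
  have P_sub: "P i \<subseteq> \<Omega> \<inter> U i" for i unfolding P_def by (rule disjointed_subset)
  have P_disj: "disjoint_family P" unfolding P_def by (rule disjoint_family_disjointed)
  have P_UN: "(\<Union>i. P i) = \<Omega>" unfolding P_def UN_disjointed_eq using U_cover by auto
  have "range P \<subseteq> sets lebesgue"
    unfolding P_def using U_open \<Omega>(1) by (intro sets.range_disjointed_sets) auto
  then have P_leb: "P i \<in> sets lebesgue" for i by auto
  have "\<exists>C T. fsigma_in euclidean C \<and> T \<in> null_sets lebesgue \<and> C \<union> T = P i \<and> C \<inter> T = {}" for i
  proof -
    obtain C T where CT: "fsigma C" "T \<in> null_sets lebesgue" "C \<union> T = P i" "disjnt C T"
      using lebesgue_set_almost_fsigma[OF P_leb[of i]] .
    obtain F :: "nat \<Rightarrow> complex set" where F: "range F \<subseteq> Collect compact" "C = \<Union>(range F)"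
      using CT(1) fsigma_Union_compact by metis
    have "fsigma_in euclidean C"
      unfolding F(2) using F(1)
      by (intro fsigma_in_Union) (auto intro!: closed_imp_fsigma_in compact_imp_closed)
    then show ?thesis using CT by (auto simp: disjnt_def)
  qed
  then obtain C T where C: "\<And>i. fsigma_in euclidean (C i)" and T: "\<And>i. T i \<in> null_sets lebesgue"
    and CT: "\<And>i. C i \<union> T i = P i" "\<And>i. C i \<inter> T i = {}"
    by metis
  have C_sub: "C i \<subseteq> U i" and T_sub: "T i \<subseteq> U i" for i using CT(1)[of i] P_sub[of i] by auto
  \<comment> \<open>Only the F-sigma parts are counted, which keeps \<open>g\<close>
    measurable.\<close>
  define g where "g x = (\<Sum>i. emeasure (count_space UNIV) {z\<in>C i. lin_comb x z = 0})" for x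
  have m [measurable]: "(\<lambda>x. emeasure (count_space UNIV) {z\<in>C i. lin_comb x z = 0}) \<in> borel_measurable \<gamma>" for i
    by (rule borel_measurable_count_lin_comb[OF C])
  have gm: "g \<in> borel_measurable \<gamma>" unfolding g_def using m by (rule borel_measurable_suminf_order)
  have "AE x in \<gamma>. \<forall>z\<in>T i. lin_comb x z \<noteq> 0" for i
  proof (cases "good (prod_decode i)")
    case True
    then show ?thesis using T[of i] T_sub[of i]
      by (intro AE_no_zero_null_set[of "fst (prod_decode i)" "snd (prod_decode i)"]) (auto simp: U_def good_def)
  next
    case False
    then have "T i = {}" using T_sub[of i] by (auto simp: U_def)
    then show ?thesis by simp
  qed
  then have "AE x in \<gamma>. \<forall>i. \<forall>z\<in>T i. lin_comb x z \<noteq> 0" by (simp add: AE_all_countable)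
  then have count: "AE x in \<gamma>. emeasure (count_space UNIV) {z\<in>\<Omega>. lin_comb x z = 0} = g x"
  proof eventually_elim
    case (elim x)
    have "{z\<in>\<Omega>. lin_comb x z = 0} = (\<Union>i. {z\<in>C i. lin_comb x z = 0})"
      using elim CT(1) P_UN by blast
    moreover have "disjoint_family (\<lambda>i. {z\<in>C i. lin_comb x z = 0})"
      using P_disj CT(1) unfolding disjoint_family_on_def by blast
    ultimately show ?case
      unfolding g_def by (simp add: suminf_emeasure)
  qed
  have "AE x in \<gamma>. \<forall>z\<in>U i. lin_comb x z = 0 \<longrightarrow> lin_comb' x z \<noteq> 0" for i
    using AE_simple_zeros_indep_pair[of "fst (prod_decode i)" "snd (prod_decode i)"]
    by (cases "good (prod_decode i)") (auto simp: U_def good_def)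
  then have "AE x in \<gamma>. \<forall>i. \<forall>z\<in>U i. lin_comb x z = 0 \<longrightarrow> lin_comb' x z \<noteq> 0" by (simp add: AE_all_countable)
  then have simple: "AE x in \<gamma>. \<forall>z\<in>\<Omega>. lin_comb x z = 0 \<longrightarrow> lin_comb' x z \<noteq> 0"
    by eventually_elim (use U_cover in blast)
  have h [measurable]: "(\<lambda>z. ennreal (zero_density n f z)) \<in> borel_measurable lebesgue"
    by (rule measurable_completion) simp
  have "(\<integral>\<^sup>+x. g x \<partial>\<gamma>) = (\<Sum>i. \<integral>\<^sup>+x. emeasure (count_space UNIV) {z\<in>C i. lin_comb x z = 0} \<partial>\<gamma>)"
    unfolding g_def using m by (rule nn_integral_suminf)
  also have "\<dots> = (\<Sum>i. \<integral>\<^sup>+z. ennreal (zero_density n f z) * indicator (P i) z \<partial>lebesgue)"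
  proof (rule suminf_cong)
    fix i
    have "(\<integral>\<^sup>+x. emeasure (count_space UNIV) {z\<in>C i. lin_comb x z = 0} \<partial>\<gamma>)
        = (\<integral>\<^sup>+z\<in>C i. ennreal (zero_density n f z) \<partial>lborel)"
    proof (cases "good (prod_decode i)")
      case True
      then show ?thesis using C_sub[of i]
        by (intro nn_integral_count_lin_comb[OF _ _ _ C, of "fst (prod_decode i)" "snd (prod_decode i)"])
           (auto simp: U_def good_def)
    next
      case False
      then have "C i = {}" using C_sub[of i] by (auto simp: U_def)
      then show ?thesis by simp
    qed
    also have "\<dots> = (\<integral>\<^sup>+z\<in>C i. ennreal (zero_density n f z) \<partial>lebesgue)"
      by (simp add: nn_integral_completion)
    also have "\<dots> = (\<integral>\<^sup>+z. ennreal (zero_density n f z) * indicator (P i) z \<partial>lebesgue)"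
      by (intro nn_integral_cong_AE eventually_mono[OF AE_not_in[OF T[of i]]])
         (use CT(1)[of i] in \<open>auto simp: indicator_def\<close>)
    finally show "(\<integral>\<^sup>+x. emeasure (count_space UNIV) {z\<in>C i. lin_comb x z = 0} \<partial>\<gamma>) = \<dots>" .
  qed
  also have "\<dots> = (\<integral>\<^sup>+z. (\<Sum>i. ennreal (zero_density n f z) * indicator (P i) z) \<partial>lebesgue)"
    using P_leb by (intro nn_integral_suminf[symmetric] borel_measurable_times_ennreal h borel_measurable_indicator)
  also have "\<dots> = (\<integral>\<^sup>+z\<in>\<Omega>. ennreal (zero_density n f z) \<partial>lebesgue)"
    using suminf_indicator[OF P_disj] by (simp add: P_UN)
  finally show ?thesis using that gm count simple by blast
qed

end


section \<open>Transfer to the given probability space\<close>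

lemma measurable_completion_AE:
  assumes f: "f \<in> M \<rightarrow>\<^sub>M N" and ae: "AE x in M. f x = g x" and sp: "\<And>x. x \<in> space M \<Longrightarrow> g x \<in> space N"
  shows "g \<in> completion M \<rightarrow>\<^sub>M N"
proof (rule measurableI)
  fix A assume A: "A \<in> sets N"
  obtain T where T: "T \<in> null_sets M" "{x\<in>space M. \<not> f x = g x} \<subseteq> T"
    using ae unfolding eventually_ae_filter by auto
  \<comment> \<open>Off the null set \<open>T\<close> the preimages under \<open>f\<close> and
    \<open>g\<close> agree; inside \<open>T\<close> every subset is measurable in the
    completion.\<close>
  have eq: "g -` A \<inter> space (completion M) = (f -` A \<inter> space M - T) \<union> (g -` A \<inter> space M \<inter> T)"
    using T(2) by auto
  have "g -` A \<inter> space M \<inter> T \<in> sets (completion M)"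
    using T(1) by (intro null_sets_completion[of T]) auto
  moreover have "f -` A \<inter> space M - T \<in> sets (completion M)"
    using measurable_sets[OF f A] T(1) by (intro sets_completionI_sets) auto
  ultimately show "g -` A \<inter> space (completion M) \<in> sets (completion M)"
    unfolding eq by (intro sets.Un)
qed (use sp in simp)

text \<open>A zero with nonzero derivative has order 1 and rules out the zero function, hence the
  multiplicity \<infinity>.\<close>

lemma num_zeros_eq_emeasure_count:
  assumes der: "\<And>z. (g has_field_derivative g' z) (at z)"
    and simple: "\<And>z. z \<in> \<Omega> \<Longrightarrow> g z = 0 \<Longrightarrow> g' z \<noteq> 0"
  shows "num_zeros g \<Omega> = emeasure (count_space UNIV) {z\<in>\<Omega>. g z = 0}"
proof -
  have hol: "g holomorphic_on UNIV"
    using der by (auto simp: holomorphic_on_open)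
  have mult: "zero_mult g z = indicator {z. g z = 0} z" if "z \<in> \<Omega>" for z
  proof (cases "g z = 0")
    case True
    then have nz: "g' z \<noteq> 0" using simple that by auto
    have "\<not> (\<forall>w. g w = 0)"
    proof
      assume "\<forall>w. g w = 0"
      then have "g = (\<lambda>_. 0)" by auto
      then have "(g has_field_derivative 0) (at z)" by simp
      then show False using DERIV_unique[OF der] nz by blast
    qed
    moreover have "zorder g z = 1"
      using True nz DERIV_imp_deriv[OF der] by (intro zorder_zero_eqI[OF hol]) auto
    ultimately show ?thesis using True by (simp add: zero_mult_def)
  qed (simp add: zero_mult_def)
  have "num_zeros g \<Omega> = (\<integral>\<^sup>+z. zero_mult g z * indicator \<Omega> z \<partial>count_space UNIV)"
    unfolding num_zeros_def by (cases "\<Omega> = UNIV") (simp_all add: nn_integral_count_space_indicator)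
  also have "\<dots> = (\<integral>\<^sup>+z. indicator {z\<in>\<Omega>. g z = 0} z \<partial>count_space UNIV)"
    by (intro nn_integral_cong) (auto simp: mult indicator_def)
  finally show ?thesis by simp
qed

text \<open>The coefficient vector has law \<open>\<gamma>\<close>, so
  \<open>expected_zero_count\<close> transfers; almost surely all zeros in \<open>\<Omega>\<close>
  are simple, so multiplicity does not change the count. The count agrees with a measurable function
  only almost surely, hence \<open>completion M\<close>. Nonnegativity of the density is part of the
  conclusion because \<open>ennreal\<close> would cut negative values to 0.\<close>

theorem theorem1p1:
  fixes n :: nat
    and f :: "nat \<Rightarrow> complex \<Rightarrow> complex"
    and M :: "'a measure"
    and \<eta> :: "nat \<Rightarrow> 'a \<Rightarrow> real"
    and \<Omega> :: "complex set"
  assumes "prob_space M"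
    and "\<And>j. j \<le> n \<Longrightarrow> f j holomorphic_on UNIV"
    and "\<And>j x. j \<le> n \<Longrightarrow> f j (complex_of_real x) \<in> \<real>"
    and "prob_space.indep_vars M (\<lambda>_. borel) \<eta> {..n}"
    and "\<And>j. j \<le> n \<Longrightarrow> distributed M lborel (\<eta> j) (\<lambda>x. ennreal (std_normal_density x))"
    and "\<Omega> \<in> sets lebesgue"
    and "\<Omega> \<subseteq> {z. D\<^sub>0 n f z \<noteq> 0}"
  shows "(\<lambda>\<omega>. num_zeros (random_sum n f \<eta> \<omega>) \<Omega>) \<in> borel_measurable (completion M)
    \<and> (\<forall>z\<in>\<Omega>. 0 \<le> zero_density n f z)
    \<and> (\<integral>\<^sup>+ \<omega>. num_zeros (random_sum n f \<eta> \<omega>) \<Omega> \<partial>completion M)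
        = (\<integral>\<^sup>+ z\<in>\<Omega>. ennreal (zero_density n f z) \<partial>lebesgue)"
proof -
  interpret prob_space M by fact
  interpret entire_family n f by standard (rule assms(2))
  \<comment> \<open>The coefficient vector, restricted to \<open>{..n}\<close> so that it takes
    values in the product space.\<close>
  define X where "X = (\<lambda>\<omega>. \<lambda>i\<in>{..n}. \<eta> i \<omega>)"
  have rv: "\<eta> i \<in> borel_measurable M" if "i \<in> {..n}" for i
    using distributed_measurable[OF assms(5)] that by simp
  have "distr M (Pi\<^sub>M {..n} (\<lambda>_. borel)) X = Pi\<^sub>M {..n} (\<lambda>i. distr M borel (\<eta> i))"
    using assms(4) indep_vars_iff_distr_eq_PiM'[where I = "{..n}" and X = \<eta> and M' = "\<lambda>_. borel"] rv by (simp add: X_def)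
  also have "\<dots> = \<gamma>"
  proof (rule PiM_cong[OF refl])
    fix i assume "i \<in> {..n}"
    then have "distr M lborel (\<eta> i) = std_gauss" using distributed_distr_eq_density[OF assms(5)] by simp
    then show "distr M borel (\<eta> i) = std_gauss" by (simp cong: distr_cong)
  qed
  finally have distr_X: "distr M (Pi\<^sub>M {..n} (\<lambda>_. borel)) X = \<gamma>" .
  have X: "X \<in> M \<rightarrow>\<^sub>M Pi\<^sub>M {..n} (\<lambda>_. borel)"
    unfolding X_def by (intro measurable_restrict rv)
  then have X': "X \<in> M \<rightarrow>\<^sub>M \<gamma>" using measurable_cong_sets[OF refl sets_PiM_std_gauss] by blast
  have lin: "random_sum n f \<eta> \<omega> = lin_comb (X \<omega>)" for \<omega>
    by (auto simp: random_sum_def lin_comb_def X_def fun_eq_iff)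
  obtain g where g: "g \<in> borel_measurable \<gamma>"
    "AE x in \<gamma>. emeasure (count_space UNIV) {z\<in>\<Omega>. lin_comb x z = 0} = g x"
    "(\<integral>\<^sup>+x. g x \<partial>\<gamma>) = (\<integral>\<^sup>+z\<in>\<Omega>. ennreal (zero_density n f z) \<partial>lebesgue)"
    "AE x in \<gamma>. \<forall>z\<in>\<Omega>. lin_comb x z = 0 \<longrightarrow> lin_comb' x z \<noteq> 0"
    using expected_zero_count[OF assms(6,7)] .
  have "AE x in \<gamma>. g x = num_zeros (lin_comb x) \<Omega>"
    using g(2,4)
  proof eventually_elim
    case (elim x)
    then show ?case using num_zeros_eq_emeasure_count[OF lin_comb_deriv, of \<Omega> x] by auto
  qed
  then have "AE x in distr M (Pi\<^sub>M {..n} (\<lambda>_. borel)) X. g x = num_zeros (lin_comb x) \<Omega>"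
    by (simp only: distr_X)
  then have ae: "AE \<omega> in M. g (X \<omega>) = num_zeros (random_sum n f \<eta> \<omega>) \<Omega>"
    unfolding lin by (rule AE_distrD[OF X])
  have "(\<integral>\<^sup>+\<omega>. num_zeros (random_sum n f \<eta> \<omega>) \<Omega> \<partial>completion M) = (\<integral>\<^sup>+\<omega>. g (X \<omega>) \<partial>M)"
    unfolding nn_integral_completion using ae by (intro nn_integral_cong_AE) auto
  also have "\<dots> = (\<integral>\<^sup>+x. g x \<partial>distr M (Pi\<^sub>M {..n} (\<lambda>_. borel)) X)"
    using g(1) by (intro nn_integral_distr[OF X, symmetric]) (simp add: measurable_cong_sets[OF sets_PiM_std_gauss refl])
  finally have "(\<integral>\<^sup>+\<omega>. num_zeros (random_sum n f \<eta> \<omega>) \<Omega> \<partial>completion M)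
      = (\<integral>\<^sup>+z\<in>\<Omega>. ennreal (zero_density n f z) \<partial>lebesgue)"
    unfolding distr_X g(3) .
  moreover have "(\<lambda>\<omega>. num_zeros (random_sum n f \<eta> \<omega>) \<Omega>) \<in> borel_measurable (completion M)"
    using measurable_compose[OF X' g(1)] ae by (rule measurable_completion_AE) simp
  moreover have "0 \<le> zero_density n f z" if z: "z \<in> \<Omega>" for z
  proof -
    have "D\<^sub>0 n f z \<noteq> 0" using z assms(7) by auto
    then obtain j k where jk: "j \<le> n" "k \<le> n" "z \<in> indep_pair j k" by (rule D\<^sub>0_nonzero_imp_indep_pair)
    moreover have "j \<noteq> k" using jk by (auto simp: indep_pair_def)
    ultimately show ?thesis using nn_integral_conditional(2) by blast
  qed
  ultimately show ?thesis by blast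
qed

end
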